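(* Let $T$ be the Bel-Robinson tensor of a Weyl tensor $W$ and suppose that $\operatorname{Tr}T^3=0$ and $4t^2\equiv\operatorname{Tr}T^2\neq0$ ($t>0$). Then the Weyl tensor can be obtained from $T$, up to duality rotation, as $$W=\cos\theta\,W_0+\sin\theta\,*W_0,\qquad W_0=\sqrt t\;\frac{P(X)\wedge P(X)-Q(X)\wedge Q(X)}{\sqrt{[P(X,X)]^2-[Q(X,X)]^2}},$$ where $\theta$ is real, $X=u\otimes u$, $u$ being an arbitrary time-like vector such that $\Pi_1(u)\neq u$, and where $$P=\frac{1}{2t}T+\frac1{2t^2}T^2,\qquad V_{\alpha\beta\mu\nu}=2P_{\alpha\rho\mu\sigma}P_{\beta}{}^{\rho}{}_{\nu}{}^{\sigma}-\tfrac14 g_{\alpha\beta}g_{\mu\nu},\qquad \Pi_1=\frac{V(X)}{\sqrt{V(X,X)}},\qquad Q=2\,\Pi_1\cdot P .$$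
   Context: $(V,g)$ is an oriented 4-dimensional real vector space with a Lorentzian metric of signature $(-,+,+,+)$ (the tangent space of a space-time at a point); indices are moved with $g$; $\eta$ is the metric volume element. Hodge dual on double 2-forms: $( *W)_{\alpha\beta\mu\nu}=\frac12\eta_{\alpha\beta}{}^{\rho\sigma}W_{\rho\sigma\mu\nu}$. A Weyl tensor $W$ is a real 4-tensor with the algebraic symmetries of a Riemann tensor and vanishing traces; its self-dual Weyl tensor is $\mathcal W=\frac12(W-\mathrm i*W)$. The Bel-Robinson tensor of $W$ is $T_{\alpha\mu\beta\nu}=\mathcal W_{\alpha}{}^{\rho}{}_{\beta}{}^{\sigma}\,\overline{\mathcal W}_{\mu\rho\nu\sigma}$; it is real, totally symmetric and traceless. Powers and trace are as endomorphisms of symmetric tensors: $(T^2)_{\alpha\beta\rho\sigma}=T_{\alpha\beta}{}^{\mu\nu}T_{\mu\nu\rho\sigma}$, $T^3$ similarly, $\operatorname{Tr}T=T^{\alpha\beta}{}_{\alpha\beta}$. $(\Pi_1\cdot P)_{\alpha\beta\mu\nu}=(\Pi_1)_{\alpha}{}^{\rho}P_{\rho\beta\mu\nu}$ and $\Pi_1(u)^\alpha=(\Pi_1)^\alpha{}_\beta u^\beta$. For a 4-tensor $S$: $S(X)_{\alpha\beta}=S_{\alpha\beta\mu\nu}X^{\mu\nu}$, $S(X,X)=S_{\alpha\beta\mu\nu}X^{\alpha\beta}X^{\mu\nu}$. For 2-tensors $A,B$: $(A\wedge B)_{\alpha\beta\mu\nu}=A_{\alpha\mu}B_{\beta\nu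}+B_{\alpha\mu}A_{\beta\nu}-A_{\alpha\nu}B_{\beta\mu}-B_{\alpha\nu}A_{\beta\mu}$.
   Formalization: The formal theorem also requires [P(X,X)]²−[Q(X,X)]² ≠ 0 for the time-like u, since Π₁(u) ≠ u holds for every time-like u and W₀ is 0/0 for some of them (e.g. the time axis of a canonical frame); it proves that such u exist. *)

theory Defs
  imports "HOL-Analysis.Analysis"
begin

text \<open>
  The tangent space is represented by \<^typ>\<open>real^4\<close>, i.e. by components with respect to an
  arbitrary basis, in which the metric is an arbitrary symmetric matrix of signature
  (-,+,+,+). All tensors carry lower indices, given as functions of their
  indices; indices are raised by explicit contraction with the inverse metric. Only vectors
  and \<open>X = u \<otimes> u\<close> are contravariant.
\<close>

type_synonym 'a tensor2 = "4 \<Rightarrow> 4 \<Rightarrow> 'a"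
type_synonym 'a tensor4 = "4 \<Rightarrow> 4 \<Rightarrow> 4 \<Rightarrow> 4 \<Rightarrow> 'a"

definition minkowski :: "real^4^4" where
  "minkowski = (\<chi> i j. if i = j then (if i = 1 then - 1 else 1) else 0)"

text \<open>The columns of \<open>A\<close> form an orthonormal basis.\<close>

definition lorentzian :: "real^4^4 \<Rightarrow> bool" where
  "lorentzian g \<longleftrightarrow> transpose g = g \<and>
     (\<exists>A. invertible A \<and> transpose A ** g ** A = minkowski)"

definition timelike :: "real^4^4 \<Rightarrow> real^4 \<Rightarrow> bool" where
  "timelike g u \<longleftrightarrow> (\<Sum>\<alpha>\<in>UNIV. \<Sum>\<beta>\<in>UNIV. g $ \<alpha> $ \<beta> * u $ \<alpha> * u $ \<beta>) < 0"

definition ginv :: "real^4^4 \<Rightarrow> real tensor2" where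
  "ginv g \<alpha> \<beta> = matrix_inv g $ \<alpha> $ \<beta>"

definition levi_civita :: "real tensor4" where
  "levi_civita \<alpha> \<beta> \<mu> \<nu> = det (vector [axis \<alpha> 1, axis \<beta> 1, axis \<mu> 1, axis \<nu> 1] :: real^4^4)"

text \<open>The orientation of the space is the sign \<open>s\<close>, either 1 or -1, of the
  coordinate basis, so that both orientations (equivalently, both sign conventions for the volume
  element) are covered.\<close>

definition volume_element :: "real^4^4 \<Rightarrow> real \<Rightarrow> real tensor4" where
  "volume_element g s \<alpha> \<beta> \<mu> \<nu> = s * sqrt \<bar>det g\<bar> * levi_civita \<alpha> \<beta> \<mu> \<nu>"

definition hodge :: "real^4^4 \<Rightarrow> real \<Rightarrow> real tensor4 \<Rightarrow> real tensor4" where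
  "hodge g s W \<alpha> \<beta> \<mu> \<nu> =
     (1/2) * (\<Sum>\<rho>\<in>UNIV. \<Sum>\<sigma>\<in>UNIV. \<Sum>\<kappa>\<in>UNIV. \<Sum>\<tau>\<in>UNIV.
        volume_element g s \<alpha> \<beta> \<kappa> \<tau> * ginv g \<kappa> \<rho> * ginv g \<tau> \<sigma> * W \<rho> \<sigma> \<mu> \<nu>)"

definition weyl_tensor :: "real^4^4 \<Rightarrow> real tensor4 \<Rightarrow> bool" where
  "weyl_tensor g W \<longleftrightarrow>
     (\<forall>\<alpha> \<beta> \<mu> \<nu>. W \<beta> \<alpha> \<mu> \<nu> = - W \<alpha> \<beta> \<mu> \<nu> \<and> W \<alpha> \<beta> \<nu> \<mu> = - W \<alpha> \<beta> \<mu> \<nu>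
        \<and> W \<mu> \<nu> \<alpha> \<beta> = W \<alpha> \<beta> \<mu> \<nu>
        \<and> W \<alpha> \<beta> \<mu> \<nu> + W \<alpha> \<mu> \<nu> \<beta> + W \<alpha> \<nu> \<beta> \<mu> = 0) \<and>
     (\<forall>\<beta> \<nu>. (\<Sum>\<alpha>\<in>UNIV. \<Sum>\<mu>\<in>UNIV. ginv g \<alpha> \<mu> * W \<alpha> \<beta> \<mu> \<nu>) = 0)"

definition self_dual_weyl :: "real^4^4 \<Rightarrow> real \<Rightarrow> real tensor4 \<Rightarrow> complex tensor4" where
  "self_dual_weyl g s W \<alpha> \<beta> \<mu> \<nu> =
     (1/2) * (complex_of_real (W \<alpha> \<beta> \<mu> \<nu>) - \<i> * complex_of_real (hodge g s W \<alpha> \<beta> \<mu> \<nu>))"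

text \<open>For a Weyl tensor the complex sum below is real; taking the real part only
  converts its type.\<close>

definition bel_robinson :: "real^4^4 \<Rightarrow> real \<Rightarrow> real tensor4 \<Rightarrow> real tensor4" where
  "bel_robinson g s W \<alpha> \<mu> \<beta> \<nu> =
     Re (\<Sum>\<rho>\<in>UNIV. \<Sum>\<sigma>\<in>UNIV. \<Sum>\<kappa>\<in>UNIV. \<Sum>\<tau>\<in>UNIV.
        complex_of_real (ginv g \<rho> \<kappa> * ginv g \<sigma> \<tau>)
          * self_dual_weyl g s W \<alpha> \<kappa> \<beta> \<tau> * cnj (self_dual_weyl g s W \<mu> \<rho> \<nu> \<sigma>))"

definition comp4 :: "real^4^4 \<Rightarrow> real tensor4 \<Rightarrow> real tensor4 \<Rightarrow> real tensor4" where
  "comp4 g S R \<alpha> \<beta> \<rho> \<sigma> =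
     (\<Sum>\<mu>\<in>UNIV. \<Sum>\<nu>\<in>UNIV. \<Sum>\<kappa>\<in>UNIV. \<Sum>\<tau>\<in>UNIV.
        S \<alpha> \<beta> \<kappa> \<tau> * ginv g \<kappa> \<mu> * ginv g \<tau> \<nu> * R \<mu> \<nu> \<rho> \<sigma>)"

definition tr4 :: "real^4^4 \<Rightarrow> real tensor4 \<Rightarrow> real" where
  "tr4 g S = (\<Sum>\<alpha>\<in>UNIV. \<Sum>\<beta>\<in>UNIV. \<Sum>\<mu>\<in>UNIV. \<Sum>\<nu>\<in>UNIV.
     ginv g \<alpha> \<mu> * ginv g \<beta> \<nu> * S \<mu> \<nu> \<alpha> \<beta>)"

definition app4 :: "real tensor4 \<Rightarrow> real tensor2 \<Rightarrow> real tensor2" where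
  "app4 S X \<alpha> \<beta> = (\<Sum>\<mu>\<in>UNIV. \<Sum>\<nu>\<in>UNIV. S \<alpha> \<beta> \<mu> \<nu> * X \<mu> \<nu>)"

definition quad4 :: "real tensor4 \<Rightarrow> real tensor2 \<Rightarrow> real" where
  "quad4 S X = (\<Sum>\<alpha>\<in>UNIV. \<Sum>\<beta>\<in>UNIV. \<Sum>\<mu>\<in>UNIV. \<Sum>\<nu>\<in>UNIV. S \<alpha> \<beta> \<mu> \<nu> * X \<alpha> \<beta> * X \<mu> \<nu>)"

definition wedge :: "real tensor2 \<Rightarrow> real tensor2 \<Rightarrow> real tensor4" where
  "wedge A B \<alpha> \<beta> \<mu> \<nu> = A \<alpha> \<mu> * B \<beta> \<nu> + B \<alpha> \<mu> * A \<beta> \<nu> - A \<alpha> \<nu> * B \<beta> \<mu> - B \<alpha> \<nu> * A \<beta> \<mu>"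

definition act4 :: "real^4^4 \<Rightarrow> real tensor2 \<Rightarrow> real tensor4 \<Rightarrow> real tensor4" where
  "act4 g A S \<alpha> \<beta> \<mu> \<nu> = (\<Sum>\<rho>\<in>UNIV. \<Sum>\<kappa>\<in>UNIV. A \<alpha> \<kappa> * ginv g \<kappa> \<rho> * S \<rho> \<beta> \<mu> \<nu>)"

definition act_vec :: "real^4^4 \<Rightarrow> real tensor2 \<Rightarrow> real^4 \<Rightarrow> real^4" where
  "act_vec g A u = (\<chi> \<alpha>. \<Sum>\<beta>\<in>UNIV. \<Sum>\<kappa>\<in>UNIV. ginv g \<alpha> \<kappa> * A \<kappa> \<beta> * u $ \<beta>)"

definition sq_tensor :: "real^4 \<Rightarrow> real tensor2" where
  "sq_tensor u \<alpha> \<beta> = u $ \<alpha> * u $ \<beta>"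

definition P_tensor :: "real^4^4 \<Rightarrow> real \<Rightarrow> real tensor4 \<Rightarrow> real tensor4" where
  "P_tensor g t T \<alpha> \<beta> \<mu> \<nu> = 1 / (2 * t) * T \<alpha> \<beta> \<mu> \<nu> + 1 / (2 * t\<^sup>2) * comp4 g T T \<alpha> \<beta> \<mu> \<nu>"

definition V_tensor :: "real^4^4 \<Rightarrow> real tensor4 \<Rightarrow> real tensor4" where
  "V_tensor g P \<alpha> \<beta> \<mu> \<nu> =
     2 * (\<Sum>\<rho>\<in>UNIV. \<Sum>\<sigma>\<in>UNIV. \<Sum>\<kappa>\<in>UNIV. \<Sum>\<tau>\<in>UNIV.
        P \<alpha> \<rho> \<mu> \<sigma> * ginv g \<rho> \<kappa> * ginv g \<sigma> \<tau> * P \<beta> \<kappa> \<nu> \<tau>)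
     - 1/4 * g $ \<alpha> $ \<beta> * g $ \<mu> $ \<nu>"

definition Pi1 :: "real tensor4 \<Rightarrow> real tensor2 \<Rightarrow> real tensor2" where
  "Pi1 V X \<alpha> \<beta> = app4 V X \<alpha> \<beta> / sqrt (quad4 V X)"

definition Q_tensor :: "real^4^4 \<Rightarrow> real tensor2 \<Rightarrow> real tensor4 \<Rightarrow> real tensor4" where
  "Q_tensor g A P \<alpha> \<beta> \<mu> \<nu> = 2 * act4 g A P \<alpha> \<beta> \<mu> \<nu>"

text \<open>For the tensors of interest the radicand is a square, but it vanishes together with the
  numerator of \<open>W\<^sub>0\<close> for certain time-like \<open>u\<close> (for instance the time axis of a canonical frame of
  the Weyl tensor), where \<open>W\<^sub>0\<close> is undefined.\<close>

definition W0_radicand :: "real tensor4 \<Rightarrow> real tensor4 \<Rightarrow> real tensor2 \<Rightarrow> real" where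
  "W0_radicand P Q X = (quad4 P X)\<^sup>2 - (quad4 Q X)\<^sup>2"

definition W0_tensor :: "real \<Rightarrow> real tensor4 \<Rightarrow> real tensor4 \<Rightarrow> real tensor2 \<Rightarrow> real tensor4" where
  "W0_tensor t P Q X \<alpha> \<beta> \<mu> \<nu> =
     sqrt t * ((wedge (app4 P X) (app4 P X) \<alpha> \<beta> \<mu> \<nu> - wedge (app4 Q X) (app4 Q X) \<alpha> \<beta> \<mu> \<nu>)
       / sqrt (W0_radicand P Q X))"

end

theory Submission
  imports Defs
begin

text \<open>
  In an orthonormal frame the self-dual Weyl tensor is a quadratic form \<open>M\<close> on the space of self-dual
  bivectors, that is, a complex symmetric traceless 3 by 3 matrix. Self-dual and anti-self-dual
  bivectors commute as endomorphisms, so their products are symmetric 2-tensors, and on these the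
  Bel-Robinson tensor acts as the Kronecker product of \<open>M\<close> and its conjugate:
  \<open>Tr T\<^sup>n = 4\<^sup>n \<bar>tr M\<^sup>n\<bar>\<^sup>2\<close>. Hence the hypotheses mean that \<open>M\<close> has the three distinct eigenvalues \<open>l\<close>,
  \<open>- l\<close>, 0 with \<open>t = 4 \<bar>l\<bar>\<^sup>2\<close>, so that \<open>M = l (a a\<^sup>T - b b\<^sup>T)\<close> for orthonormal complex vectors \<open>a\<close>, \<open>b\<close>.
  If \<open>U\<^sub>a\<close>, \<open>U\<^sub>b\<close> are the corresponding bivectors and \<open>p\<^sub>a\<close>, \<open>p\<^sub>b\<close> their products with their conjugates,
  then \<open>P = (p\<^sub>a p\<^sub>a + p\<^sub>b p\<^sub>b) / 4\<close>, and \<open>p\<^sub>a\<close>, \<open>p\<^sub>b\<close> are commuting involutions, whose product \<open>p\<^sub>c\<close> is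
  definite on time-like vectors. This gives \<open>V = p\<^sub>c p\<^sub>c / 4\<close>, \<open>\<Pi>\<^sub>1 = - p\<^sub>c / 2\<close> and
  \<open>Q = - (p\<^sub>a p\<^sub>b + p\<^sub>b p\<^sub>a) / 4\<close>, and \<open>W\<^sub>0\<close> is a multiple of \<open>p\<^sub>a \<and> p\<^sub>a - p\<^sub>b \<and> p\<^sub>b\<close>, which is
  proportional to the real part of \<open>U\<^sub>a U\<^sub>a - U\<^sub>b U\<^sub>b\<close>. Duality rotation multiplies the latter by a phase.
\<close>

section \<open>Matrices, Kronecker products and tensors\<close>

abbreviation cmat :: "real^'n^'m \<Rightarrow> complex^'n^'m" where
  "cmat \<equiv> map_matrix complex_of_real"

abbreviation cnjm :: "complex^'n^'m \<Rightarrow> complex^'n^'m" where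
  "cnjm \<equiv> map_matrix cnj"

lemma cmat_mult: "cmat (A ** B) = cmat A ** cmat B"
  by (simp add: vec_eq_iff matrix_matrix_mult_def)

lemma cmat_transpose: "cmat (transpose A) = transpose (cmat A)"
  by (simp add: vec_eq_iff transpose_def)

lemma cmat_one: "cmat (mat 1) = mat 1"
  by (simp add: vec_eq_iff mat_def)

lemma cmat_inject: "cmat A = cmat B \<longleftrightarrow> A = B"
  by (simp add: vec_eq_iff)

lemma cmat_trace: "trace (cmat A) = of_real (trace A)"
  by (simp add: trace_def)

lemma cnjm_cmat: "cnjm (cmat A) = cmat A"
  by (simp add: vec_eq_iff)

lemma cnjm_mult: "cnjm (A ** B) = cnjm A ** cnjm B"
  by (simp add: vec_eq_iff matrix_matrix_mult_def)

lemma cnjm_transpose: "cnjm (transpose A) = transpose (cnjm A)"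
  by (simp add: vec_eq_iff transpose_def)

lemma trace_cnjm: "trace (cnjm A) = cnj (trace A)"
  by (simp add: trace_def)

lemma sum_prod_UNIV:
  "(\<Sum>p\<in>UNIV. f p) = (\<Sum>a\<in>UNIV. \<Sum>b\<in>UNIV. f (a, b))"
  for f :: "'a::finite \<times> 'b::finite \<Rightarrow> 'c::comm_monoid_add"
  by (simp add: sum.cartesian_product flip: UNIV_Times_UNIV)

definition kron :: "'a::times^'n^'m \<Rightarrow> 'a^'q^'p \<Rightarrow> 'a^('n \<times> 'q)^('m \<times> 'p)" where
  "kron A B = (\<chi> i j. A $ fst i $ fst j * B $ snd i $ snd j)"

lemma kron_nth [simp]: "kron A B $ (i, k) $ (j, l) = A $ i $ j * B $ k $ l"
  by (simp add: kron_def)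

lemma kron_mult: "kron A B ** kron C D = kron (A ** C) (B ** D)"
  for A :: "'a::comm_semiring_1^'n^'m"
  by (simp add: vec_eq_iff matrix_matrix_mult_def sum_prod_UNIV sum_product)
     (simp add: ac_simps)

lemma kron_transpose: "transpose (kron A B) = kron (transpose A) (transpose B)"
  by (simp add: vec_eq_iff transpose_def kron_def)

lemma kron_one: "kron (mat 1) (mat 1) = (mat 1 :: 'a::comm_semiring_1^('n::finite \<times> 'm::finite)^('n \<times> 'm))"
  by (auto simp: vec_eq_iff mat_def kron_def)

lemma kron_trace: "trace (kron A B) = trace A * trace B"
  for A :: "'a::comm_semiring_1^'n^'n"
  by (simp add: trace_def kron_def sum_prod_UNIV sum_product)

lemma kron_cmat: "cmat (kron A B) = kron (cmat A) (cmat B)"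
  by (simp add: vec_eq_iff kron_def)

text \<open>A 4-tensor is read as a matrix whose rows are indexed by its first and columns by its last pair
  of indices; composition of such tensors is then matrix multiplication with \<open>kron H H\<close> in
  between, where \<open>H\<close> is the inverse metric.\<close>

definition mat4 :: "'a tensor4 \<Rightarrow> 'a^(4\<times>4)^(4\<times>4)" where
  "mat4 S = (\<chi> p q. S (fst p) (snd p) (fst q) (snd q))"

lemma mat4_nth [simp]: "mat4 S $ (\<alpha>, \<beta>) $ (\<mu>, \<nu>) = S \<alpha> \<beta> \<mu> \<nu>"
  by (simp add: mat4_def)

lemma mat4_comp4:
  "mat4 (comp4 g S R) = mat4 S ** kron (matrix_inv g) (matrix_inv g) ** mat4 R"
proof -
  have "comp4 g S R \<alpha> \<beta> \<rho> \<sigma> =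
      (\<Sum>\<mu>\<in>UNIV. \<Sum>\<nu>\<in>UNIV. (\<Sum>\<kappa>\<in>UNIV. \<Sum>\<tau>\<in>UNIV.
        S \<alpha> \<beta> \<kappa> \<tau> * (matrix_inv g $ \<kappa> $ \<mu> * matrix_inv g $ \<tau> $ \<nu>)) * R \<mu> \<nu> \<rho> \<sigma>)" for \<alpha> \<beta> \<rho> \<sigma>
    by (simp add: comp4_def ginv_def sum_distrib_right mult.assoc)
  then show ?thesis
    by (simp add: vec_eq_iff matrix_matrix_mult_def sum_prod_UNIV)
qed

lemma tr4_mat4: "tr4 g S = trace (kron (matrix_inv g) (matrix_inv g) ** mat4 S)"
  by (simp add: tr4_def ginv_def trace_def matrix_matrix_mult_def sum_prod_UNIV)

lemma mat4_hodge:
  "mat4 (hodge g s W) =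
     (1/2) *\<^sub>R (mat4 (volume_element g s) ** kron (matrix_inv g) (matrix_inv g) ** mat4 W)"
proof -
  have "hodge g s W \<alpha> \<beta> \<mu> \<nu> =
      (1/2) * (\<Sum>\<rho>\<in>UNIV. \<Sum>\<sigma>\<in>UNIV. (\<Sum>\<kappa>\<in>UNIV. \<Sum>\<tau>\<in>UNIV.
        volume_element g s \<alpha> \<beta> \<kappa> \<tau> * (matrix_inv g $ \<kappa> $ \<rho> * matrix_inv g $ \<tau> $ \<sigma>)) * W \<rho> \<sigma> \<mu> \<nu>)" for \<alpha> \<beta> \<mu> \<nu>
    by (simp add: hodge_def ginv_def sum_distrib_right mult.assoc)
  then show ?thesis
    by (simp add: vec_eq_iff matrix_matrix_mult_def sum_prod_UNIV)
qed

section \<open>Determinants of order four and their multilinear expansion\<close>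

lemma vector_4 [simp]:
  "(vector [a,b,c,d] :: 'a::zero^4) $ 1 = a" "(vector [a,b,c,d] :: 'a::zero^4) $ 2 = b"
  "(vector [a,b,c,d] :: 'a::zero^4) $ 3 = c" "(vector [a,b,c,d] :: 'a::zero^4) $ 4 = d"
  unfolding vector_def by simp_all

lemma det_4:
  "det (A::'a::comm_ring_1^4^4) =
     A$1$1 * (A$2$2 * (A$3$3 * A$4$4 - A$3$4 * A$4$3) - A$2$3 * (A$3$2 * A$4$4 - A$3$4 * A$4$2)
       + A$2$4 * (A$3$2 * A$4$3 - A$3$3 * A$4$2))
   - A$1$2 * (A$2$1 * (A$3$3 * A$4$4 - A$3$4 * A$4$3) - A$2$3 * (A$3$1 * A$4$4 - A$3$4 * A$4$1)
       + A$2$4 * (A$3$1 * A$4$3 - A$3$3 * A$4$1))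
   + A$1$3 * (A$2$1 * (A$3$2 * A$4$4 - A$3$4 * A$4$2) - A$2$2 * (A$3$1 * A$4$4 - A$3$4 * A$4$1)
       + A$2$4 * (A$3$1 * A$4$2 - A$3$2 * A$4$1))
   - A$1$4 * (A$2$1 * (A$3$2 * A$4$3 - A$3$3 * A$4$2) - A$2$2 * (A$3$1 * A$4$3 - A$3$3 * A$4$1)
       + A$2$3 * (A$3$1 * A$4$2 - A$3$2 * A$4$1))"
proof -
  have f1234: "finite {2::4, 3, 4}" "1 \<notin> {2::4, 3, 4}"
    by auto
  have f234: "finite {3::4, 4}" "2 \<notin> {3::4, 4}"
    by auto
  have f34: "finite {4::4}" "3 \<notin> {4::4}"
    by auto
  show ?thesis
    unfolding det_def UNIV_4
    unfolding sum_over_permutations_insert[OF f1234]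
    unfolding sum_over_permutations_insert[OF f234]
    unfolding sum_over_permutations_insert[OF f34]
    unfolding permutes_sing
    by (simp add: sign_swap_id permutation_swap_id permutation_compose sign_compose sign_id swap_id_eq)
       (simp add: algebra_simps)
qed

text \<open>Multilinearity of the determinant in its last two rows. With the counterpart for the
  first two rows it evaluates contractions of the Levi-Civita symbol with frame vectors.\<close>

lemma det_vector_expand_34:
  "(\<Sum>\<kappa>\<in>UNIV. \<Sum>\<tau>\<in>UNIV. det (vector [a, b, axis \<kappa> 1, axis \<tau> 1] :: real^4^4) * c $ \<kappa> * d $ \<tau>)
     = det (vector [a, b, c, d] :: real^4^4)"
  unfolding det_4 vector_4 sum_4 by (simp add: axis_def algebra_simps)

lemma det_vector_expand_12:
  "(\<Sum>\<kappa>\<in>UNIV. \<Sum>\<tau>\<in>UNIV. a $ \<kappa> * b $ \<tau> * det (vector [axis \<kappa> 1, axis \<tau> 1, c, d] :: real^4^4))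
     = det (vector [a, b, c, d] :: real^4^4)"
  unfolding det_4 vector_4 sum_4 by (simp add: axis_def algebra_simps)

lemma vector_mult_matrix:
  "(vector [a, b, c, d] :: real^4^4) ** A = vector [a v* A, b v* A, c v* A, d v* A]"
  by (simp add: vec_eq_iff forall_4 matrix_matrix_mult_def vector_matrix_mult_def mult.commute)

section \<open>Self-dual bivectors in an orthonormal frame\<close>

definition eta :: "complex^4^4" where
  "eta = cmat minkowski"

lemma eta_nth: "eta $ i $ j = (if i = j then (if i = 1 then -1 else 1) else 0)"
  by (simp add: eta_def minkowski_def)

text \<open>The bivector \<open>F\<close> with \<open>F\<^sub>1\<^sub>i = z\<^sub>i\<close> (index 1 is the time axis) and \<open>*F = \<i> F\<close>; see
  \<open>frame_hodge_sdcol\<close>.\<close>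

definition sd :: "complex^3 \<Rightarrow> complex^4^4" where
  "sd z = vector [
     vector [0, z$1, z$2, z$3],
     vector [- z$1, 0, \<i> * z$3, - \<i> * z$2],
     vector [- z$2, - \<i> * z$3, 0, \<i> * z$1],
     vector [- z$3, \<i> * z$2, - \<i> * z$1, 0]]"

text \<open>The bilinear extension of the Euclidean product, without conjugation, since this is the
  invariant that the Clifford relation produces; nonzero vectors can be null.\<close>

definition cdot :: "complex^3 \<Rightarrow> complex^3 \<Rightarrow> complex" where
  "cdot z w = (\<Sum>i\<in>UNIV. z $ i * w $ i)"

lemma sd_antisym: "transpose (sd z) = - sd z"
  by (simp add: vec_eq_iff forall_4 transpose_def sd_def)

text \<open>The Clifford relation; together with \<open>sd_commute\<close> it carries all the algebra below.\<close>

lemma sd_eta_sd: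
  "sd z ** eta ** sd w + sd w ** eta ** sd z = mat (2 * cdot z w) ** eta"
  by (simp add: vec_eq_iff forall_4 matrix_matrix_mult_def sum_4 eta_nth sd_def cdot_def sum_3 mat_def)
     (auto simp: algebra_simps)

lemma sd_commute:
  "sd z ** eta ** cnjm (sd w) = cnjm (sd w) ** eta ** sd z"
  by (simp add: vec_eq_iff forall_4 matrix_matrix_mult_def sum_4 eta_nth sd_def)
     (auto simp: algebra_simps)

lemma sd_square: "cdot z z = 1 \<Longrightarrow> sd z ** eta ** sd z = eta"
  using sd_eta_sd[of z z]
  by (simp add: vec_eq_iff matrix_matrix_mult_def mat_def if_distrib if_distribR sum.delta cong: if_cong)

lemma sd_anticommute: "cdot z w = 0 \<Longrightarrow> sd z ** eta ** sd w = - (sd w ** eta ** sd z)"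
  using sd_eta_sd[of z w] by (simp add: eq_neg_iff_add_eq_0)

text \<open>The product of a self-dual and an anti-self-dual bivector. For \<open>z = w\<close> it
  is, up to a constant factor, the Maxwell energy-momentum tensor of the field \<open>z\<close>; the
  transposition makes the energy density nonnegative.\<close>

definition herm :: "complex^3 \<Rightarrow> complex^3 \<Rightarrow> complex^4^4" where
  "herm z w = sd z ** eta ** transpose (cnjm (sd w))"

lemma herm_explicit:
  "herm z w = vector [
     vector [z$1 * cnj (w$1) + z$2 * cnj (w$2) + z$3 * cnj (w$3),
       - \<i> * (z$2 * cnj (w$3) - z$3 * cnj (w$2)),
       - \<i> * (z$3 * cnj (w$1) - z$1 * cnj (w$3)),
       - \<i> * (z$1 * cnj (w$2) - z$2 * cnj (w$1))],
     vector [- \<i> * (z$2 * cnj (w$3) - z$3 * cnj (w$2)),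
       - z$1 * cnj (w$1) + z$2 * cnj (w$2) + z$3 * cnj (w$3),
       - z$1 * cnj (w$2) - z$2 * cnj (w$1),
       - z$1 * cnj (w$3) - z$3 * cnj (w$1)],
     vector [- \<i> * (z$3 * cnj (w$1) - z$1 * cnj (w$3)),
       - z$1 * cnj (w$2) - z$2 * cnj (w$1),
       z$1 * cnj (w$1) - z$2 * cnj (w$2) + z$3 * cnj (w$3),
       - z$2 * cnj (w$3) - z$3 * cnj (w$2)],
     vector [- \<i> * (z$1 * cnj (w$2) - z$2 * cnj (w$1)),
       - z$1 * cnj (w$3) - z$3 * cnj (w$1),
       - z$2 * cnj (w$3) - z$3 * cnj (w$2),
       z$1 * cnj (w$1) + z$2 * cnj (w$2) - z$3 * cnj (w$3)]]"
  by (simp add: herm_def vec_eq_iff forall_4 matrix_matrix_mult_def transpose_def sum_4 eta_nth sd_def)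
     (auto simp: algebra_simps)

text \<open>The scalar product of two such tensors splits into one factor for each of the two kinds
  of bivectors. Hence the nine tensors built from basis vectors are orthogonal.\<close>

lemma herm_gram:
  "trace (eta ** herm z w ** eta ** herm z' w') = 4 * cdot z z' * cnj (cdot w w')"
  unfolding herm_explicit
  by (simp add: trace_def matrix_matrix_mult_def sum_4 eta_nth cdot_def sum_3)
     (simp add: algebra_simps)

text \<open>Here \<open>p\<close> is a covector, so that orthogonality is the plain pairing with
  \<open>y\<close>. It bounds the time component of \<open>p\<close> by the Cauchy-Schwarz
  inequality for the space components, strictly because \<open>y\<close> is time-like.\<close>

lemma minkowski_orthogonal_spacelike:
  fixes y p :: "real^4"
  assumes "y \<bullet> (minkowski *v y) < 0" "p \<bullet> y = 0" "p \<noteq> 0"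
  shows "p \<bullet> (minkowski *v p) > 0"
proof -
  define P where "P = (p$2)\<^sup>2 + (p$3)\<^sup>2 + (p$4)\<^sup>2"
  define Y where "Y = (y$2)\<^sup>2 + (y$3)\<^sup>2 + (y$4)\<^sup>2"
  have form: "v \<bullet> (minkowski *v v) = - (v$1)\<^sup>2 + ((v$2)\<^sup>2 + (v$3)\<^sup>2 + (v$4)\<^sup>2)" for v
    by (simp add: inner_vec_def matrix_vector_mult_def sum_4 minkowski_def power2_eq_square)
  have Y: "Y < (y$1)\<^sup>2"
    using assms(1) by (simp add: form Y_def)
  have py: "p$1 * y$1 = - (p$2 * y$2 + p$3 * y$3 + p$4 * y$4)"
    using assms(2) by (simp add: inner_vec_def sum_4)
  \<comment> \<open>Lagrange's identity in three dimensions, from which the Cauchy-Schwarz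
    inequality follows.\<close>
  have "(p$2 * y$2 + p$3 * y$3 + p$4 * y$4)\<^sup>2 + (p$2 * y$3 - p$3 * y$2)\<^sup>2
      + (p$2 * y$4 - p$4 * y$2)\<^sup>2 + (p$3 * y$4 - p$4 * y$3)\<^sup>2 = P * Y"
    unfolding P_def Y_def by (simp add: power2_eq_square algebra_simps)
  then have "(p$2 * y$2 + p$3 * y$3 + p$4 * y$4)\<^sup>2 \<le> P * Y"
    by (smt (verit) zero_le_power2)
  then have le: "(p$1)\<^sup>2 * (y$1)\<^sup>2 \<le> P * Y"
    by (metis py power2_minus power_mult_distrib)
  have Y0: "0 \<le> Y" and P0: "0 \<le> P" by (auto simp: Y_def P_def)
  have "P \<noteq> 0"
  proof
    assume "P = 0"
    then have "(p$1)\<^sup>2 * (y$1)\<^sup>2 \<le> 0" using le by simp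
    then have "p$1 = 0" using Y Y0
      by (smt (verit) mult_eq_0_iff mult_nonneg_nonneg power2_eq_square zero_le_power2 zero_eq_power2)
    moreover have "p$2 = 0" "p$3 = 0" "p$4 = 0"
      using \<open>P = 0\<close> unfolding P_def by (smt (verit) zero_le_power2 zero_eq_power2)+
    ultimately show False using assms(3) by (simp add: vec_eq_iff forall_4)
  qed
  then have "P * Y < P * (y$1)\<^sup>2" using P0 Y by simp
  then have "(p$1)\<^sup>2 * (y$1)\<^sup>2 < P * (y$1)\<^sup>2" using le by linarith
  then have "(p$1)\<^sup>2 < P" using Y Y0
    by (smt (verit) mult_right_less_imp_less)
  then show ?thesis by (simp add: form P_def)
qed

text \<open>The covector \<open>e = y K\<close> is nonzero, and its real and imaginary parts annihilate the time-like
  vector \<open>y\<close>, hence are space-like.\<close>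

lemma antisym_herm_pos:
  assumes anti: "transpose K = - K" and inv: "K ** eta ** K ** eta = mat c" "c \<noteq> 0"
    and q: "cmat q = K ** eta ** transpose (cnjm K)"
    and y: "y \<bullet> (minkowski *v y) < 0"
  shows "y \<bullet> (q *v y) > 0"
proof -
  define e where "e k = (\<Sum>a\<in>UNIV. of_real (y$a) * K $ a $ k)" for k
  define p where "p = (\<chi> k. Re (e k))"
  define r where "r = (\<chi> k. Im (e k))"
  have anti': "K $ a $ b = - K $ b $ a" for a b
    using arg_cong[OF anti, of "\<lambda>A. A $ b $ a"] by (simp add: transpose_def)
  have "(\<Sum>k\<in>UNIV. e k * of_real (y$k)) = 0"
  proof -
    define f where "f a k = of_real (y$a) * K $ a $ k * of_real (y$k)" for a k
    have f: "f a k = - f k a" for a k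
      unfolding f_def by (subst anti') (simp add: mult_ac)
    have "(\<Sum>k\<in>UNIV. e k * of_real (y$k)) = (\<Sum>k\<in>UNIV. \<Sum>a\<in>UNIV. f a k)"
      by (simp add: e_def sum_distrib_right f_def)
    moreover have "(\<Sum>k\<in>UNIV. \<Sum>a\<in>UNIV. f a k) = (\<Sum>k\<in>UNIV. \<Sum>a\<in>UNIV. f k a)"
      by (rule sum.swap)
    moreover have "(\<Sum>k\<in>UNIV. \<Sum>a\<in>UNIV. f a k) = - (\<Sum>k\<in>UNIV. \<Sum>a\<in>UNIV. f k a)"
      unfolding sum_negf[symmetric] by (intro sum.cong refl f)
    ultimately show ?thesis by simp
  qed
  then have orth: "p \<bullet> y = 0" "r \<bullet> y = 0"
    by (simp_all add: complex_eq_iff p_def r_def inner_vec_def)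
  \<comment> \<open>The value of \<open>q\<close> at \<open>y\<close> is the Hermitian square of
    \<open>e\<close> in the Minkowski metric, which is the sum of the squares of the real and
    imaginary parts.\<close>
  have "complex_of_real (y \<bullet> (q *v y)) = (\<Sum>a\<in>UNIV. \<Sum>b\<in>UNIV. of_real (y$a) * (cmat q $ a $ b) * of_real (y$b))"
    by (simp add: inner_vec_def matrix_vector_mult_def sum_distrib_left mult_ac)
  also have "\<dots> = (\<Sum>k\<in>UNIV. eta $ k $ k * (e k * cnj (e k)))"
    unfolding q
    by (simp add: e_def matrix_matrix_mult_def transpose_def eta_nth sum_4 algebra_simps)
  also have "\<dots> = of_real (p \<bullet> (minkowski *v p) + r \<bullet> (minkowski *v r))"
    by (simp add: complex_mult_cnj eta_nth p_def r_def inner_vec_def matrix_vector_mult_def sum_4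
        minkowski_def power2_eq_square)
  finally have eq: "y \<bullet> (q *v y) = p \<bullet> (minkowski *v p) + r \<bullet> (minkowski *v r)"
    by (simp only: of_real_eq_iff)
  have "p \<noteq> 0 \<or> r \<noteq> 0"
  proof (rule ccontr)
    assume "\<not> ?thesis"
    then have e0: "e k = 0" for k
      by (metis complex_eq_iff p_def r_def vec_lambda_beta zero_complex.simps zero_index)
    \<comment> \<open>If \<open>e\<close> vanished, applying the remaining factors of
      \<open>K ** eta ** K ** eta\<close> to it would give \<open>c y = 0\<close>.\<close>
    have "c * of_real (y$b) = (\<Sum>a\<in>UNIV. of_real (y$a) * (K ** eta ** K ** eta) $ a $ b)" for b
      unfolding inv by (simp add: mat_def if_distrib cong: if_cong)
    also have "\<dots> b = (\<Sum>k\<in>UNIV. e k * (eta ** K ** eta) $ k $ b)" for b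
    proof -
      have "K ** eta ** K ** eta = K ** (eta ** K ** eta)" by (simp add: matrix_mul_assoc)
      then show ?thesis
        by (simp add: e_def matrix_matrix_mult_def[of K] sum_distrib_left sum_distrib_right mult_ac)
           (rule sum.swap)
    qed
    finally have "y $ b = 0" for b using e0 inv(2) by simp
    then have "y = 0" by (simp add: vec_eq_iff)
    then show False using y by simp
  qed
  moreover have "p \<bullet> (minkowski *v p) \<ge> 0" "r \<bullet> (minkowski *v r) \<ge> 0"
    using minkowski_orthogonal_spacelike[OF y orth(1)] minkowski_orthogonal_spacelike[OF y orth(2)]
    by (cases "p = 0"; cases "r = 0"; force)+
  ultimately show ?thesis
    using eq minkowski_orthogonal_spacelike[OF y orth(1)] minkowski_orthogonal_spacelike[OF y orth(2)]
    by fastforce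
qed

section \<open>Hodge dual and Weyl tensors in an orthonormal frame\<close>

lemma matrix_inv_unique:
  assumes "A ** B = mat 1" "B ** A = mat 1"
  shows "matrix_inv A = B"
  unfolding matrix_inv_def
proof (rule some_equality)
  show "A ** B = mat 1 \<and> B ** A = mat 1"
    using assms by simp
  show "X = B" if "A ** X = mat 1 \<and> X ** A = mat 1" for X
  proof -
    have "X = (B ** A) ** X" by (simp add: assms)
    also have "\<dots> = B ** (A ** X)" by (simp add: matrix_mul_assoc)
    finally show ?thesis using that by simp
  qed
qed

lemma matrix_inv_minkowski: "matrix_inv minkowski = minkowski"
  by (rule matrix_inv_unique)
    (simp_all add: vec_eq_iff forall_4 matrix_matrix_mult_def sum_4 minkowski_def mat_def)

text \<open>Both orders of the contracted pair contribute equally, whence the factor 2. The entries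
  lie in any real algebra, so that the formula serves real tensors as well as complex
  bivectors.\<close>

lemma frame_star:
  fixes F :: "4 \<Rightarrow> 4 \<Rightarrow> 'a::real_algebra_1"
  assumes "\<And>\<rho> \<sigma>. F \<sigma> \<rho> = - F \<rho> \<sigma>"
  shows "(\<Sum>\<rho>\<in>UNIV. \<Sum>\<sigma>\<in>UNIV. of_real (levi_civita \<alpha> \<beta> \<rho> \<sigma> * minkowski $ \<rho> $ \<rho> * minkowski $ \<sigma> $ \<sigma>) * F \<rho> \<sigma>)
    = 2 * (vector [
        vector [0, F 3 4, F 4 2, F 2 3],
        vector [- F 3 4, 0, - F 1 4, F 1 3],
        vector [- F 4 2, F 1 4, 0, - F 1 2],
        vector [- F 2 3, - F 1 3, F 1 2, 0]] :: 'a^4^4) $ \<alpha> $ \<beta>"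
proof -
  have "\<forall>\<alpha> \<beta>. (\<Sum>\<rho>\<in>UNIV. \<Sum>\<sigma>\<in>UNIV. of_real (levi_civita \<alpha> \<beta> \<rho> \<sigma> * minkowski $ \<rho> $ \<rho> * minkowski $ \<sigma> $ \<sigma>) * F \<rho> \<sigma>)
    = 2 * (vector [
        vector [0, F 3 4, F 4 2, F 2 3],
        vector [- F 3 4, 0, - F 1 4, F 1 3],
        vector [- F 4 2, F 1 4, 0, - F 1 2],
        vector [- F 2 3, - F 1 3, F 1 2, 0]] :: 'a^4^4) $ \<alpha> $ \<beta>"
    unfolding forall_4 sum_4
    apply (intro conjI)
    apply (simp_all add: levi_civita_def det_4 axis_def minkowski_def)
    apply (simp_all add: assms[of 3 2] assms[of 4 2] assms[of 4 3] assms[of 2 1] assms[of 3 1] assms[of 4 1])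
    apply (simp_all add: mult_2)
    done
  then show ?thesis by blast
qed

text \<open>The columns are a basis of the self-dual bivectors, each written as a vector with 16
  entries.\<close>

definition sdcol :: "complex^3^(4 \<times> 4)" where
  "sdcol = (\<chi> p i. sd (axis i 1) $ fst p $ snd p)"

lemma sdcol_nth [simp]: "sdcol $ (\<alpha>, \<beta>) $ i = sd (axis i 1) $ \<alpha> $ \<beta>"
  by (simp add: sdcol_def)

text \<open>Duality has the eigenvalue \<i> on these bivectors; the 2 appears because the factor 1/2
  of \<open>hodge\<close> is left out.\<close>

lemma frame_hodge_sdcol:
  "cmat (mat4 levi_civita) ** kron eta eta ** sdcol = mat (2 * \<i>) ** sdcol"
proof -
  have anti: "sd z $ \<sigma> $ \<rho> = - sd z $ \<rho> $ \<sigma>" for z \<rho> \<sigma>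
    using arg_cong[OF sd_antisym, of "\<lambda>A. A $ \<rho> $ \<sigma>"] by (simp add: transpose_def)
  have "(cmat (mat4 levi_civita) ** kron eta eta ** sdcol) $ (\<alpha>, \<beta>) $ i =
    (\<Sum>\<rho>\<in>UNIV. \<Sum>\<sigma>\<in>UNIV. of_real (levi_civita \<alpha> \<beta> \<rho> \<sigma> * minkowski $ \<rho> $ \<rho> * minkowski $ \<sigma> $ \<sigma>)
      * sd (axis i 1) $ \<rho> $ \<sigma>)" for \<alpha> \<beta> i
    by (simp add: matrix_matrix_mult_def sum_prod_UNIV sdcol_def eta_nth sum_4 minkowski_def)
  moreover have "(mat (2 * \<i>) ** sdcol) $ (\<alpha>, \<beta>) $ i = 2 * (\<i> * sd (axis i 1) $ \<alpha> $ \<beta>)" for \<alpha> \<beta> i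
    by (simp add: matrix_matrix_mult_def mat_def sdcol_def if_distrib if_distribR cong: if_cong)
  moreover have "\<forall>\<alpha> \<beta>. vector [
        vector [0, sd z $ 3 $ 4, sd z $ 4 $ 2, sd z $ 2 $ 3],
        vector [- sd z $ 3 $ 4, 0, - sd z $ 1 $ 4, sd z $ 1 $ 3],
        vector [- sd z $ 4 $ 2, sd z $ 1 $ 4, 0, - sd z $ 1 $ 2],
        vector [- sd z $ 2 $ 3, - sd z $ 1 $ 3, sd z $ 1 $ 2, 0]] $ \<alpha> $ \<beta> = \<i> * sd z $ \<alpha> $ \<beta>" for z
    unfolding forall_4 by (simp add: sd_def)
  ultimately show ?thesis
    by (simp add: vec_eq_iff frame_star[OF anti] del: of_real_mult)
qed

lemma volume_element_minkowski: "volume_element minkowski 1 = levi_civita"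
proof -
  have "det minkowski = -1" by (simp add: det_4 minkowski_def)
  then show ?thesis by (simp add: volume_element_def fun_eq_iff)
qed

lemma hodge_minkowski:
  assumes "\<And>\<alpha> \<beta> \<mu> \<nu>. w \<beta> \<alpha> \<mu> \<nu> = - w \<alpha> \<beta> \<mu> \<nu>"
  shows "hodge minkowski 1 w \<alpha> \<beta> \<mu> \<nu> = (vector [
        vector [0, w 3 4 \<mu> \<nu>, w 4 2 \<mu> \<nu>, w 2 3 \<mu> \<nu>],
        vector [- w 3 4 \<mu> \<nu>, 0, - w 1 4 \<mu> \<nu>, w 1 3 \<mu> \<nu>],
        vector [- w 4 2 \<mu> \<nu>, w 1 4 \<mu> \<nu>, 0, - w 1 2 \<mu> \<nu>],
        vector [- w 2 3 \<mu> \<nu>, - w 1 3 \<mu> \<nu>, w 1 2 \<mu> \<nu>, 0]] :: real^4^4) $ \<alpha> $ \<beta>"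
proof -
  have "hodge minkowski 1 w \<alpha> \<beta> \<mu> \<nu> =
    (1/2) * (\<Sum>\<rho>\<in>UNIV. \<Sum>\<sigma>\<in>UNIV. of_real (levi_civita \<alpha> \<beta> \<rho> \<sigma> * minkowski $ \<rho> $ \<rho> * minkowski $ \<sigma> $ \<sigma>)
      * w \<rho> \<sigma> \<mu> \<nu>)"
    unfolding hodge_def ginv_def matrix_inv_minkowski volume_element_minkowski sum_4
    by (simp add: minkowski_def)
  also note frame_star[of "\<lambda>\<rho> \<sigma>. w \<rho> \<sigma> \<mu> \<nu>", OF assms]
  finally show ?thesis by simp
qed

text \<open>The ten real components of a Weyl tensor are the five complex ones of a symmetric
  traceless matrix.\<close>

lemma self_dual_weyl_minkowski:
  assumes "weyl_tensor minkowski w"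
  obtains M where "transpose M = M" "trace M = 0"
    "(\<chi> p q. self_dual_weyl minkowski 1 w (fst p) (snd p) (fst q) (snd q)) = sdcol ** M ** transpose sdcol"
proof -
  note W = assms[unfolded weyl_tensor_def]
  have anti1: "w \<beta> \<alpha> \<mu> \<nu> = - w \<alpha> \<beta> \<mu> \<nu>" and anti2: "w \<alpha> \<beta> \<nu> \<mu> = - w \<alpha> \<beta> \<mu> \<nu>"
    and sym: "w \<mu> \<nu> \<alpha> \<beta> = w \<alpha> \<beta> \<mu> \<nu>"
    and bianchi: "w \<alpha> \<beta> \<mu> \<nu> + w \<alpha> \<mu> \<nu> \<beta> + w \<alpha> \<nu> \<beta> \<mu> = 0" for \<alpha> \<beta> \<mu> \<nu>
    using W by blast+
  have tr: "- w 1 \<beta> 1 \<nu> + w 2 \<beta> 2 \<nu> + w 3 \<beta> 3 \<nu> + w 4 \<beta> 4 \<nu> = 0" for \<beta> \<nu>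
  proof -
    have "(\<Sum>\<alpha>\<in>UNIV. \<Sum>\<mu>\<in>UNIV. ginv minkowski \<alpha> \<mu> * w \<alpha> \<beta> \<mu> \<nu>) = 0" using W by blast
    then show ?thesis
      unfolding ginv_def matrix_inv_minkowski by (simp add: sum_4 minkowski_def)
  qed
  have diag1: "w \<alpha> \<alpha> \<mu> \<nu> = 0" and diag2: "w \<alpha> \<beta> \<mu> \<mu> = 0" for \<alpha> \<beta> \<mu> \<nu>
    using anti1[of \<alpha> \<alpha> \<mu> \<nu>] anti2[of \<alpha> \<beta> \<mu> \<mu>] by simp_all
  note A1 = anti1[of 2 1] anti1[of 3 1] anti1[of 4 1] anti1[of 3 2] anti1[of 4 2] anti1[of 4 3]
  note A2 = anti2[of _ _ 2 1] anti2[of _ _ 3 1] anti2[of _ _ 4 1] anti2[of _ _ 3 2] anti2[of _ _ 4 2] anti2[of _ _ 4 3]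
  note S = sym[of 1 3 1 2] sym[of 1 4 1 2] sym[of 2 3 1 2] sym[of 2 4 1 2] sym[of 3 4 1 2]
    sym[of 1 4 1 3] sym[of 2 3 1 3] sym[of 2 4 1 3] sym[of 3 4 1 3]
    sym[of 2 3 1 4] sym[of 2 4 1 4] sym[of 3 4 1 4] sym[of 2 4 2 3] sym[of 3 4 2 3] sym[of 3 4 2 4]
  note base = diag1 diag2 A1 A2 S
  \<comment> \<open>The trace conditions and one instance of the Bianchi identity reduce everything
    to ten components.\<close>
  have red: "w 1 4 1 4 = - w 1 2 1 2 - w 1 3 1 3" "w 3 4 3 4 = - w 1 2 1 2" "w 2 4 2 4 = - w 1 3 1 3"
    "w 2 3 2 3 = w 1 2 1 2 + w 1 3 1 3"
    "w 1 4 2 4 = - w 1 3 2 3" "w 1 4 3 4 = w 1 2 2 3" "w 1 3 3 4 = - w 1 2 2 4"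
    "w 2 4 3 4 = w 1 2 1 3" "w 2 3 3 4 = - w 1 2 1 4" "w 2 3 2 4 = w 1 3 1 4"
    "w 1 4 2 3 = w 1 3 2 4 - w 1 2 3 4"
    using tr[of 1 1] tr[of 2 2] tr[of 3 3] tr[of 4 4] tr[of 1 2] tr[of 1 3] tr[of 1 4] tr[of 2 3]
      tr[of 2 4] tr[of 3 4] bianchi[of 1 2 3 4] by (simp_all add: base)
  \<comment> \<open>Because \<open>sd z\<close> has the first row \<open>(0, z)\<close>, the entries
    of \<open>M\<close> must be the time-space components of the self-dual tensor: half the electric
    part plus \<i> times minus half the magnetic part.\<close>
  define M :: "complex^3^3" where "M = vector [
     vector [Complex (w 1 2 1 2 / 2) (- w 1 2 3 4 / 2), Complex (w 1 2 1 3 / 2) (w 1 2 2 4 / 2),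
       Complex (w 1 2 1 4 / 2) (- w 1 2 2 3 / 2)],
     vector [Complex (w 1 2 1 3 / 2) (w 1 2 2 4 / 2), Complex (w 1 3 1 3 / 2) (w 1 3 2 4 / 2),
       Complex (w 1 3 1 4 / 2) (- w 1 3 2 3 / 2)],
     vector [Complex (w 1 2 1 4 / 2) (- w 1 2 2 3 / 2), Complex (w 1 3 1 4 / 2) (- w 1 3 2 3 / 2),
       Complex (- (w 1 2 1 2 + w 1 3 1 3) / 2) ((w 1 2 3 4 - w 1 3 2 4) / 2)]]"
  have "\<forall>a b c d. self_dual_weyl minkowski 1 w a b c d = (sdcol ** M ** transpose sdcol) $ (a, b) $ (c, d)"
  proof -
    have col: "(\<Sum>i\<in>UNIV. sd (axis i 1) $ a $ b * x i) = sd (\<chi> i. x i) $ a $ b" for x a b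
    proof -
      have "\<forall>a b. (\<Sum>i\<in>UNIV. sd (axis i 1) $ a $ b * x i) = sd (\<chi> i. x i) $ a $ b"
        unfolding forall_4 sum_3 by (simp add: sd_def axis_def)
      then show ?thesis by blast
    qed
    have eq: "(sdcol ** M ** transpose sdcol) $ (a, b) $ (c, d) =
        sd (\<chi> i. sd (M $ i) $ c $ d) $ a $ b" for a b c d
    proof -
      have "sdcol ** M ** transpose sdcol = sdcol ** (M ** transpose sdcol)"
        by (simp add: matrix_mul_assoc)
      moreover have "(M ** transpose sdcol) $ i $ (c, d) = sd (M $ i) $ c $ d" for i
        using col[of c d "\<lambda>j. M $ i $ j"]
        by (simp add: matrix_matrix_mult_def transpose_def sdcol_def mult.commute)
      ultimately show ?thesis
        using col[of a b "\<lambda>i. (M ** transpose sdcol) $ i $ (c, d)"]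
        by (simp add: matrix_matrix_mult_def[of sdcol])
    qed
    show ?thesis
      unfolding eq self_dual_weyl_def hodge_minkowski[of w, OF anti1] forall_4
      by (intro conjI; simp add: sd_def M_def base red complex_eq_iff; simp add: field_simps)
  qed
  then have "(\<chi> p q. self_dual_weyl minkowski 1 w (fst p) (snd p) (fst q) (snd q)) = sdcol ** M ** transpose sdcol"
    by (simp add: vec_eq_iff)
  moreover have "transpose M = M" "trace M = 0"
    by (simp_all add: M_def vec_eq_iff forall_3 transpose_def trace_def sum_3 complex_eq_iff)
       (simp_all add: field_simps)
  ultimately show ?thesis by (rule that[rotated 2])
qed

text \<open>For unit \<open>z\<close> the metric term does not depend on \<open>z\<close>. A
  difference of two such minors therefore retains only products of bivectors, which is how
  \<open>wedge\<close> leads back to the Weyl tensor.\<close>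

lemma herm_minors:
  "herm z z $ a $ m * herm z z $ b $ n - herm z z $ a $ n * herm z z $ b $ m =
     - (cdot z z * cnj (cdot z z)) * (eta $ a $ m * eta $ b $ n - eta $ a $ n * eta $ b $ m)
     - cnj (cdot z z) * (sd z $ a $ b * sd z $ m $ n)
     - cdot z z * (cnj (sd z $ a $ b) * cnj (sd z $ m $ n))"
proof -
  have ii: "\<i> * (\<i> * x) = - x" for x by (simp flip: mult.assoc)
  have "\<forall>a m b n. herm z z $ a $ m * herm z z $ b $ n - herm z z $ a $ n * herm z z $ b $ m =
     - (cdot z z * cnj (cdot z z)) * (eta $ a $ m * eta $ b $ n - eta $ a $ n * eta $ b $ m)
     - cnj (cdot z z) * (sd z $ a $ b * sd z $ m $ n)
     - cdot z z * (cnj (sd z $ a $ b) * cnj (sd z $ m $ n))"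
    unfolding herm_explicit forall_4
    by (intro conjI; simp add: eta_nth sd_def cdot_def sum_3; simp add: algebra_simps ii)
  then show ?thesis by blast
qed

lemma transpose_minkowski: "transpose minkowski = minkowski"
  by (simp add: vec_eq_iff transpose_def minkowski_def)

section \<open>Transport from an orthonormal frame\<close>

text \<open>Reversing one space-like axis if necessary makes the frame compatible with the orientation \<open>s\<close>,
  so that the volume element has components \<open>levi_civita\<close>.\<close>

lemma oriented_frame:
  assumes "lorentzian g" "s = 1 \<or> s = - 1"
  obtains A B where "A ** B = mat 1" "B ** A = mat 1" "g = transpose B ** minkowski ** B"
    "matrix_inv g = A ** minkowski ** transpose A" "s * sqrt \<bar>det g\<bar> = det B"
    "g ** matrix_inv g = mat 1" "matrix_inv g ** g = mat 1"
proof -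
  obtain A0 where A0: "invertible A0" "transpose A0 ** g ** A0 = minkowski"
    using assms(1) by (auto simp: lorentzian_def)
  define D :: "real^4^4" where "D = (\<chi> i j. if i = j then (if i = 4 then - 1 else 1) else 0)"
  have D: "transpose D ** minkowski ** D = minkowski" "D ** D = mat 1" "det D = -1"
    by (simp_all add: vec_eq_iff forall_4 transpose_def matrix_matrix_mult_def sum_4 D_def minkowski_def det_4 mat_def)
  define A where "A = (if s * det A0 > 0 then A0 else A0 ** D)"
  have "det A0 \<noteq> 0" using A0(1) by (simp add: invertible_det_nz)
  then have pos: "s * det A > 0"
    using assms(2) by (auto simp: A_def det_mul D)
  have A: "transpose A ** g ** A = minkowski"
    using A0(2) D(1) unfolding A_def
    by (simp add: matrix_transpose_mul) (metis matrix_mul_assoc)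
  have "invertible A" using pos by (auto simp: invertible_det_nz)
  then obtain B where B: "A ** B = mat 1" "B ** A = mat 1"
    by (auto simp: invertible_def)
  have Bt: "transpose B ** transpose A = mat 1" "transpose A ** transpose B = mat 1"
    using B by (metis matrix_transpose_mul transpose_mat)+
  have "transpose B ** minkowski ** B = (transpose B ** transpose A) ** g ** (A ** B)"
    by (simp add: matrix_mul_assoc flip: A)
  then have g: "g = transpose B ** minkowski ** B" by (simp add: B Bt)
  have mm: "minkowski ** minkowski = mat 1"
    by (simp add: vec_eq_iff forall_4 matrix_matrix_mult_def sum_4 minkowski_def mat_def)
  let ?H = "A ** minkowski ** transpose A"
  have "g ** ?H = transpose B ** minkowski ** (B ** A) ** minkowski ** transpose A"
    by (simp add: g matrix_mul_assoc)
  also have "\<dots> = transpose B ** (minkowski ** minkowski) ** transpose A"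
    by (simp add: B matrix_mul_assoc)
  finally have 1: "g ** ?H = mat 1" by (simp add: mm Bt)
  then have 2: "?H ** g = mat 1" by (simp add: matrix_left_right_inverse)
  have inv: "matrix_inv g = ?H"
    using 1 2 by (rule matrix_inv_unique)
  have "det minkowski = -1" by (simp add: det_4 minkowski_def)
  then have "det g = - (det B)\<^sup>2" by (simp add: g det_mul power2_eq_square)
  then have sq: "sqrt \<bar>det g\<bar> = \<bar>det B\<bar>" by simp
  have AB: "det A * det B = 1" using B(1) by (metis det_I det_mul)
  then have "(s * det A) * (s * det B) = 1" using assms(2) by auto
  then have "s * det B > 0" using pos by (metis zero_less_mult_pos zero_less_one)
  then have "s * sqrt \<bar>det g\<bar> = det B"
    using assms(2) sq by auto
  then show ?thesis using that B g inv 1 2 by simp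
qed

text \<open>The factor \<open>det B\<close> enters the Levi-Civita determinant as a product with
  \<open>transpose B\<close>, which turns columns of \<open>A\<close> into basis vectors and basis
  vectors into columns of \<open>B\<close>.\<close>

lemma volume_element_frame:
  assumes AB: "A ** B = mat 1" "B ** A = mat 1" and vol: "s * sqrt \<bar>det g\<bar> = det B"
  shows "mat4 (volume_element g s) ** kron A A = transpose (kron B B) ** mat4 levi_civita"
proof -
  have 1: "column k A v* transpose B = axis k 1" for k
  proof -
    have "column k A v* transpose B = column k (B ** A)"
      by (simp add: vec_eq_iff column_def matrix_matrix_mult_def matrix_vector_mult_def)
    then show ?thesis by (simp add: AB vec_eq_iff column_def mat_def axis_def)
  qed
  have 2: "axis \<alpha> 1 v* transpose B = column \<alpha> B" for \<alpha>
    by (simp add: vec_eq_iff column_def matrix_vector_mult_def axis_def if_distrib cong: if_cong)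
  have "(mat4 (volume_element g s) ** kron A A) $ (\<alpha>, \<beta>) $ (k, l)
      = (transpose (kron B B) ** mat4 levi_civita) $ (\<alpha>, \<beta>) $ (k, l)" for \<alpha> \<beta> k l
  proof -
    have "(mat4 (volume_element g s) ** kron A A) $ (\<alpha>, \<beta>) $ (k, l)
        = det B * (\<Sum>\<kappa>\<in>UNIV. \<Sum>\<tau>\<in>UNIV. det (vector [axis \<alpha> 1, axis \<beta> 1, axis \<kappa> 1, axis \<tau> 1] :: real^4^4)
            * column k A $ \<kappa> * column l A $ \<tau>)"
      by (simp add: matrix_matrix_mult_def sum_prod_UNIV volume_element_def vol levi_civita_def column_def
          sum_distrib_left mult_ac)
    also have "\<dots> = det (vector [axis \<alpha> 1, axis \<beta> 1, column k A, column l A] :: real^4^4) * det (transpose B)"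
      by (simp add: det_vector_expand_34)
    also have "\<dots> = det (vector [column \<alpha> B, column \<beta> B, axis k 1, axis l 1] :: real^4^4)"
      by (simp only: det_mul[symmetric] vector_mult_matrix 1 2)
    also have "\<dots> = (transpose (kron B B) ** mat4 levi_civita) $ (\<alpha>, \<beta>) $ (k, l)"
      by (subst det_vector_expand_12[symmetric])
        (simp add: matrix_matrix_mult_def sum_prod_UNIV levi_civita_def column_def transpose_def)
    finally show ?thesis .
  qed
  then show ?thesis by (simp add: vec_eq_iff)
qed

text \<open>The components of \<open>W\<close> in the frame formed by the columns of
  \<open>A\<close>.\<close>

definition pull4 :: "real^4^4 \<Rightarrow> real tensor4 \<Rightarrow> real tensor4" where
  "pull4 A W i j k l = (\<Sum>\<alpha>\<in>UNIV. \<Sum>\<beta>\<in>UNIV. \<Sum>\<mu>\<in>UNIV. \<Sum>\<nu>\<in>UNIV.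
     A $ \<alpha> $ i * A $ \<beta> $ j * A $ \<mu> $ k * A $ \<nu> $ l * W \<alpha> \<beta> \<mu> \<nu>)"

lemma mat4_pull4: "mat4 (pull4 A W) = transpose (kron A A) ** mat4 W ** kron A A"
proof -
  have "(transpose (kron A A) ** (mat4 W ** kron A A)) $ (i, j) $ (k, l) = pull4 A W i j k l" for i j k l
    by (simp add: matrix_matrix_mult_def transpose_def sum_prod_UNIV pull4_def sum_distrib_left mult_ac)
  then show ?thesis
    by (simp add: vec_eq_iff matrix_mul_assoc)
qed

text \<open>The index symmetries survive any linear substitution; orthonormality of the frame enters
  through the trace condition.\<close>

lemma weyl_tensor_pull4:
  assumes W: "weyl_tensor g W" and inv: "matrix_inv g = A ** minkowski ** transpose A"
  shows "weyl_tensor minkowski (pull4 A W)"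
proof -
  note W = W[unfolded weyl_tensor_def]
  have anti1: "W \<beta> \<alpha> \<mu> \<nu> = - W \<alpha> \<beta> \<mu> \<nu>" and anti2: "W \<alpha> \<beta> \<nu> \<mu> = - W \<alpha> \<beta> \<mu> \<nu>"
    and sym: "W \<mu> \<nu> \<alpha> \<beta> = W \<alpha> \<beta> \<mu> \<nu>"
    and bianchi: "W \<alpha> \<beta> \<mu> \<nu> + W \<alpha> \<mu> \<nu> \<beta> + W \<alpha> \<nu> \<beta> \<mu> = 0"
    and tr: "(\<Sum>\<alpha>\<in>UNIV. \<Sum>\<mu>\<in>UNIV. ginv g \<alpha> \<mu> * W \<alpha> \<beta> \<mu> \<nu>) = 0" for \<alpha> \<beta> \<mu> \<nu>
    using W by blast+
  have swap3: "(\<Sum>x\<in>UNIV. \<Sum>y\<in>UNIV. \<Sum>z\<in>UNIV. f x y z) = (\<Sum>x\<in>UNIV. \<Sum>y\<in>UNIV. \<Sum>z\<in>UNIV. f z x y)"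
    for f :: "4 \<Rightarrow> 4 \<Rightarrow> 4 \<Rightarrow> real"
  proof -
    have "(\<Sum>x\<in>UNIV. \<Sum>y\<in>UNIV. \<Sum>z\<in>UNIV. f x y z) = (\<Sum>y\<in>UNIV. \<Sum>x\<in>UNIV. \<Sum>z\<in>UNIV. f x y z)"
      by (rule sum.swap)
    also have "\<dots> = (\<Sum>y\<in>UNIV. \<Sum>z\<in>UNIV. \<Sum>x\<in>UNIV. f x y z)"
      by (intro sum.cong refl sum.swap)
    finally show ?thesis .
  qed
  have a1: "pull4 A W j i k l = - pull4 A W i j k l" for i j k l
    unfolding pull4_def sum_negf[symmetric]
    by (rule trans[OF sum.swap], intro sum.cong refl, subst anti1, simp add: mult_ac)
  have a2: "pull4 A W i j l k = - pull4 A W i j k l" for i j k l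
    unfolding pull4_def sum_negf[symmetric]
    by (rule sum.cong[OF refl], rule sum.cong[OF refl], rule trans[OF sum.swap], intro sum.cong refl,
        subst anti2, simp add: mult_ac)
  have "transpose (mat4 W) = mat4 W"
    by (simp add: vec_eq_iff transpose_def sym)
  then have "transpose (mat4 (pull4 A W)) = mat4 (pull4 A W)"
    by (simp add: mat4_pull4 matrix_transpose_mul matrix_mul_assoc)
  then have s: "pull4 A W k l i j = pull4 A W i j k l" for i j k l
    by (auto simp: vec_eq_iff transpose_def)
  have b: "pull4 A W i j k l + pull4 A W i k l j + pull4 A W i l j k = 0" for i j k l
  proof -
    let ?f = "\<lambda>\<alpha> x y z. A $ \<alpha> $ i * A $ x $ j * A $ y $ k * A $ z $ l"
    have 1: "pull4 A W i k l j = (\<Sum>\<alpha>\<in>UNIV. \<Sum>x\<in>UNIV. \<Sum>y\<in>UNIV. \<Sum>z\<in>UNIV. ?f \<alpha> x y z * W \<alpha> y z x)"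
      unfolding pull4_def
      by (rule sum.cong[OF refl], rule trans[OF swap3], rule trans[OF swap3], intro sum.cong refl)
        (simp add: mult_ac)
    have 2: "pull4 A W i l j k = (\<Sum>\<alpha>\<in>UNIV. \<Sum>x\<in>UNIV. \<Sum>y\<in>UNIV. \<Sum>z\<in>UNIV. ?f \<alpha> x y z * W \<alpha> z x y)"
      unfolding pull4_def
      by (rule sum.cong[OF refl], rule trans[OF swap3], intro sum.cong refl)
        (simp add: mult_ac)
    show ?thesis
      unfolding 1 2 unfolding pull4_def
      by (simp add: bianchi flip: sum.distrib distrib_left)
  qed
  have t: "(\<Sum>i\<in>UNIV. \<Sum>k\<in>UNIV. ginv minkowski i k * pull4 A W i j k l) = 0" for j l
  proof -
    \<comment> \<open>In \<open>Y\<close> the second and fourth indices already refer to the frame.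
      Cyclicity of the trace moves the other two factors \<open>A\<close> onto
      \<open>minkowski\<close>, where they form the inverse metric of \<open>g\<close>.\<close>
    define Y :: "real^4^4" where
      "Y = (\<chi> \<alpha> \<mu>. \<Sum>\<beta>\<in>UNIV. \<Sum>\<nu>\<in>UNIV. A $ \<beta> $ j * A $ \<nu> $ l * W \<alpha> \<beta> \<mu> \<nu>)"
    have "pull4 A W i j k l = (transpose A ** (Y ** A)) $ i $ k" for i k
    proof -
      have "pull4 A W i j k l = (\<Sum>\<alpha>\<in>UNIV. \<Sum>\<mu>\<in>UNIV. \<Sum>\<beta>\<in>UNIV. \<Sum>\<nu>\<in>UNIV.
          A $ \<alpha> $ i * A $ \<beta> $ j * A $ \<mu> $ k * A $ \<nu> $ l * W \<alpha> \<beta> \<mu> \<nu>)"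
        unfolding pull4_def by (rule sum.cong[OF refl], rule sum.swap)
      then show ?thesis
        by (simp add: matrix_matrix_mult_def transpose_def Y_def sum_distrib_left sum_distrib_right mult_ac)
    qed
    moreover have "ginv minkowski i k = minkowski $ k $ i" for i k
      unfolding ginv_def matrix_inv_minkowski by (simp add: minkowski_def)
    ultimately have "(\<Sum>i\<in>UNIV. \<Sum>k\<in>UNIV. ginv minkowski i k * pull4 A W i j k l)
        = trace (transpose A ** Y ** A ** minkowski)"
      by (simp add: trace_def matrix_matrix_mult_def[of "transpose A ** Y ** A"] matrix_mul_assoc mult.commute)
    also have "\<dots> = trace (Y ** (A ** minkowski ** transpose A))"
      by (metis matrix_mul_assoc trace_mul_sym)
    also have "\<dots> = trace (Y ** transpose (matrix_inv g))"
      by (simp add: inv matrix_transpose_mul matrix_mul_assoc transpose_minkowski)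
    also have "\<dots> = (\<Sum>\<alpha>\<in>UNIV. \<Sum>\<mu>\<in>UNIV. \<Sum>\<beta>\<in>UNIV. \<Sum>\<nu>\<in>UNIV.
        A $ \<beta> $ j * A $ \<nu> $ l * (ginv g \<alpha> \<mu> * W \<alpha> \<beta> \<mu> \<nu>))"
      by (simp add: trace_def matrix_matrix_mult_def transpose_def Y_def ginv_def sum_distrib_left sum_distrib_right mult_ac)
    also have "\<dots> = (\<Sum>\<alpha>\<in>UNIV. \<Sum>\<beta>\<in>UNIV. \<Sum>\<nu>\<in>UNIV. \<Sum>\<mu>\<in>UNIV.
        A $ \<beta> $ j * A $ \<nu> $ l * (ginv g \<alpha> \<mu> * W \<alpha> \<beta> \<mu> \<nu>))"
      by (rule sum.cong[OF refl], rule swap3)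
    also have "\<dots> = (\<Sum>\<beta>\<in>UNIV. \<Sum>\<nu>\<in>UNIV. \<Sum>\<alpha>\<in>UNIV. \<Sum>\<mu>\<in>UNIV.
        A $ \<beta> $ j * A $ \<nu> $ l * (ginv g \<alpha> \<mu> * W \<alpha> \<beta> \<mu> \<nu>))"
      by (rule swap3)
    also have "\<dots> = 0"
      by (simp add: tr flip: sum_distrib_left)
    finally show ?thesis .
  qed
  show ?thesis
    unfolding weyl_tensor_def using a1 a2 s b t by blast
qed

lemma pull4_decompose:
  assumes "A ** B = mat 1"
  shows "mat4 W = transpose (kron B B) ** mat4 (pull4 A W) ** kron B B"
proof -
  have 1: "kron A A ** kron B B = mat 1"
    by (simp add: kron_mult assms kron_one)
  then have 2: "transpose (kron B B) ** transpose (kron A A) = mat 1"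
    by (metis matrix_transpose_mul transpose_mat)
  have "transpose (kron B B) ** mat4 (pull4 A W) ** kron B B
      = (transpose (kron B B) ** transpose (kron A A)) ** mat4 W ** (kron A A ** kron B B)"
    by (simp only: mat4_pull4 matrix_mul_assoc)
  then show ?thesis by (simp add: 1 2)
qed

text \<open>Duality commutes with the change of frame because the volume element does; the factors
  \<open>A\<close> of the inverse metric cancel against the factors \<open>B\<close> carrying
  \<open>W\<close>.\<close>

lemma hodge_frame:
  assumes AB: "A ** B = mat 1" "B ** A = mat 1" and vol: "s * sqrt \<bar>det g\<bar> = det B"
    and inv: "matrix_inv g = A ** minkowski ** transpose A"
  shows "mat4 (hodge g s W) = transpose (kron B B) ** mat4 (hodge minkowski 1 (pull4 A W)) ** kron B B"
proof -
  have 1: "kron A A ** kron B B = mat 1"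
    by (simp add: kron_mult AB kron_one)
  then have 2: "transpose (kron A A) ** transpose (kron B B) = mat 1"
    by (metis AB(2) kron_mult kron_one matrix_transpose_mul transpose_mat)
  have H: "kron (matrix_inv g) (matrix_inv g) = kron A A ** kron minkowski minkowski ** transpose (kron A A)"
    by (simp add: inv kron_mult kron_transpose)
  have "mat4 (volume_element g s) ** kron (matrix_inv g) (matrix_inv g) ** mat4 W
      = (mat4 (volume_element g s) ** kron A A) ** kron minkowski minkowski
        ** (transpose (kron A A) ** transpose (kron B B)) ** mat4 (pull4 A W) ** kron B B"
    unfolding H pull4_decompose[OF AB(1), of W] by (simp only: matrix_mul_assoc)
  also have "\<dots> = transpose (kron B B) ** (mat4 levi_civita ** kron minkowski minkowski ** mat4 (pull4 A W)) ** kron B B"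
    unfolding volume_element_frame[OF AB vol] 2 by (simp add: matrix_mul_assoc)
  finally show ?thesis
    by (simp add: mat4_hodge volume_element_minkowski matrix_inv_minkowski matrix_scalar_ac flip: scalar_matrix_assoc)
qed

section \<open>Self-dual tensors in the given basis\<close>

lemma matrix_diff_ldistrib: "A ** (B - C) = A ** B - A ** C" for A :: "'a::ring_1^'n^'m"
  by (simp add: vec_eq_iff matrix_matrix_mult_def right_diff_distrib sum_subtractf)

lemma matrix_diff_rdistrib: "(A - B) ** C = A ** C - B ** C" for A :: "'a::ring_1^'n^'m"
  by (simp add: vec_eq_iff matrix_matrix_mult_def left_diff_distrib sum_subtractf)

lemma self_dual_weyl_decomposition:
  assumes AB: "A ** B = mat 1" "B ** A = mat 1" and vol: "s * sqrt \<bar>det g\<bar> = det B"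
    and inv: "matrix_inv g = A ** minkowski ** transpose A" and W: "weyl_tensor g W"
  obtains M where "transpose M = M" "trace M = 0"
    "mat4 (self_dual_weyl g s W) = (transpose (kron (cmat B) (cmat B)) ** sdcol) ** M
       ** transpose (transpose (kron (cmat B) (cmat B)) ** sdcol)"
proof -
  obtain M where M: "transpose M = M" "trace M = 0"
    "mat4 (self_dual_weyl minkowski 1 (pull4 A W)) = sdcol ** M ** transpose sdcol"
    using self_dual_weyl_minkowski[OF weyl_tensor_pull4[OF W inv]] unfolding mat4_def by blast
  have sdw: "mat4 (self_dual_weyl g' s' W') = (1/2) *\<^sub>R (cmat (mat4 W') - map_matrix ((*) \<i>) (cmat (mat4 (hodge g' s' W'))))"
    for g' s' W'
    by (simp add: vec_eq_iff self_dual_weyl_def complex_eq_iff)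
  have imult: "map_matrix ((*) \<i>) (X ** Y) = map_matrix ((*) \<i>) X ** Y"
    "map_matrix ((*) \<i>) (X ** Y) = X ** map_matrix ((*) \<i>) Y"
    "map_matrix ((*) \<i>) (r *\<^sub>R X) = r *\<^sub>R map_matrix ((*) \<i>) X" for r and X :: "complex^'k^'m" and Y :: "complex^'n^'k"
    by (simp_all add: vec_eq_iff matrix_matrix_mult_def sum_distrib_left mult_ac)
  let ?B = "kron (cmat B) (cmat B)"
  have "mat4 (self_dual_weyl g s W) = transpose ?B ** mat4 (self_dual_weyl minkowski 1 (pull4 A W)) ** ?B"
    unfolding sdw hodge_frame[OF AB vol inv] pull4_decompose[OF AB(1), of W]
    by (simp add: cmat_mult cmat_transpose kron_cmat imult(1)[symmetric] imult(2)[symmetric] imult(3) scaleR_diff_right matrix_diff_ldistrib matrix_diff_rdistrib matrix_scalar_ac flip: scalar_matrix_assoc)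
  also have "\<dots> = (transpose ?B ** sdcol) ** M ** transpose (transpose ?B ** sdcol)"
    by (simp add: M(3) matrix_transpose_mul matrix_mul_assoc)
  finally show ?thesis using that M by blast
qed

lemma hodge_sdcol:
  assumes AB: "A ** B = mat 1" "B ** A = mat 1" and vol: "s * sqrt \<bar>det g\<bar> = det B"
    and inv: "matrix_inv g = A ** minkowski ** transpose A"
  defines "C \<equiv> transpose (kron (cmat B) (cmat B)) ** sdcol"
  shows "cmat (mat4 (volume_element g s)) ** cmat (kron (matrix_inv g) (matrix_inv g)) ** C = mat (2 * \<i>) ** C"
proof -
  have 2: "transpose (kron (cmat A) (cmat A)) ** transpose (kron (cmat B) (cmat B)) = mat 1"
    by (metis AB(2) kron_mult kron_one matrix_transpose_mul transpose_mat cmat_mult cmat_one)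
  have H: "cmat (kron (matrix_inv g) (matrix_inv g)) = kron (cmat A) (cmat A) ** kron eta eta ** transpose (kron (cmat A) (cmat A))"
    by (simp add: inv kron_mult kron_transpose kron_cmat cmat_mult cmat_transpose eta_def)
  have V: "cmat (mat4 (volume_element g s)) ** kron (cmat A) (cmat A)
      = transpose (kron (cmat B) (cmat B)) ** cmat (mat4 levi_civita)"
    using arg_cong[OF volume_element_frame[OF AB vol], of cmat]
    by (simp add: cmat_mult kron_cmat cmat_transpose)
  have "cmat (mat4 (volume_element g s)) ** cmat (kron (matrix_inv g) (matrix_inv g)) ** C
      = (cmat (mat4 (volume_element g s)) ** kron (cmat A) (cmat A)) ** kron eta eta
        ** (transpose (kron (cmat A) (cmat A)) ** transpose (kron (cmat B) (cmat B))) ** sdcol"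
    unfolding H C_def by (simp only: matrix_mul_assoc)
  also have "\<dots> = transpose (kron (cmat B) (cmat B)) ** (cmat (mat4 levi_civita) ** kron eta eta ** sdcol)"
    unfolding V 2 by (simp add: matrix_mul_assoc)
  also have "\<dots> = mat (2 * \<i>) ** C"
    unfolding frame_hodge_sdcol C_def
    by (simp add: vec_eq_iff matrix_matrix_mult_def mat_def if_distrib if_distribR sum_distrib_left mult_ac cong: if_cong)
  finally show ?thesis .
qed

section \<open>Complex symmetric matrices with eigenvalues l, -l, 0\<close>

text \<open>The adjugate \<open>E\<^sup>2 - tr E E + e\<^sub>2 1\<close> vanishes, so all 2 by 2 minors of \<open>E\<close> are zero.\<close>

lemma idempotent_symmetric_trace_one:
  fixes E :: "complex^3^3"
  assumes sym: "transpose E = E" and idem: "E ** E = E" and tr: "trace E = 1"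
  obtains z where "\<And>i j. E $ i $ j = z $ i * z $ j" "cdot z z = 1"
proof -
  have s: "E $ j $ i = E $ i $ j" for i j
    using sym by (auto simp: vec_eq_iff transpose_def)
  note S = s[of 2 1] s[of 3 1] s[of 3 2]
  have id: "E $ i $ 1 * E $ 1 $ j + E $ i $ 2 * E $ 2 $ j + E $ i $ 3 * E $ 3 $ j = E $ i $ j" for i j
    using idem by (simp add: vec_eq_iff matrix_matrix_mult_def sum_3)
  have t: "E $ 1 $ 1 + E $ 2 $ 2 + E $ 3 $ 3 = 1"
    using tr by (simp add: trace_def sum_3)
  note eqs = id[of 1 1] id[of 2 2] id[of 3 3] id[of 1 2] id[of 1 3] id[of 2 3] t
  \<comment> \<open>The sum of the principal minors of order two, which is half of
    \<open>(tr E)^2 - tr (E^2)\<close>.\<close>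
  let ?e2 = "E $ 1 $ 1 * E $ 2 $ 2 + E $ 1 $ 1 * E $ 3 $ 3 + E $ 2 $ 2 * E $ 3 $ 3 - E $ 1 $ 2 * E $ 1 $ 2 - E $ 1 $ 3 * E $ 1 $ 3 - E $ 2 $ 3 * E $ 2 $ 3"
  let ?t = "E $ 1 $ 1 + E $ 2 $ 2 + E $ 3 $ 3"
  have "2 * ?e2 = ?t * ?t - ((E $ 1 $ 1 * E $ 1 $ 1 + E $ 1 $ 2 * E $ 1 $ 2 + E $ 1 $ 3 * E $ 1 $ 3) + (E $ 1 $ 2 * E $ 1 $ 2 + E $ 2 $ 2 * E $ 2 $ 2 + E $ 2 $ 3 * E $ 2 $ 3) + (E $ 1 $ 3 * E $ 1 $ 3 + E $ 2 $ 3 * E $ 2 $ 3 + E $ 3 $ 3 * E $ 3 $ 3))"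
    by (simp add: algebra_simps)
  also have "\<dots> = 0"
    using eqs unfolding S by simp
  finally have e2: "?e2 = 0" by (metis mult_eq_0_iff zero_neq_numeral)
  \<comment> \<open>The six identities that follow are the entries of the adjugate, rewritten by
    idempotence and the values of \<open>?t\<close> and \<open>?e2\<close>.\<close>
  have "E $ 1 $ 1 * E $ 2 $ 2 = E $ 1 $ 2 * E $ 1 $ 2"
  proof -
    have "E $ 1 $ 1 * E $ 2 $ 2 - E $ 1 $ 2 * E $ 1 $ 2 = (E $ 1 $ 3 * E $ 1 $ 3 + E $ 2 $ 3 * E $ 2 $ 3 + E $ 3 $ 3 * E $ 3 $ 3) - E $ 3 $ 3 * ?t + ?e2"
      by (simp add: algebra_simps)
    also have "\<dots> = 0"
      unfolding t e2 using eqs unfolding S by (simp add: algebra_simps)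
    finally show ?thesis by simp
  qed
  moreover have "E $ 1 $ 1 * E $ 3 $ 3 = E $ 1 $ 3 * E $ 1 $ 3"
  proof -
    have "E $ 1 $ 1 * E $ 3 $ 3 - E $ 1 $ 3 * E $ 1 $ 3 = (E $ 1 $ 2 * E $ 1 $ 2 + E $ 2 $ 2 * E $ 2 $ 2 + E $ 2 $ 3 * E $ 2 $ 3) - E $ 2 $ 2 * ?t + ?e2"
      by (simp add: algebra_simps)
    also have "\<dots> = 0"
      unfolding t e2 using eqs unfolding S by (simp add: algebra_simps)
    finally show ?thesis by simp
  qed
  moreover have "E $ 2 $ 2 * E $ 3 $ 3 = E $ 2 $ 3 * E $ 2 $ 3"
  proof -
    have "E $ 2 $ 2 * E $ 3 $ 3 - E $ 2 $ 3 * E $ 2 $ 3 = (E $ 1 $ 1 * E $ 1 $ 1 + E $ 1 $ 2 * E $ 1 $ 2 + E $ 1 $ 3 * E $ 1 $ 3) - E $ 1 $ 1 * ?t + ?e2"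
      by (simp add: algebra_simps)
    also have "\<dots> = 0"
      unfolding t e2 using eqs unfolding S by (simp add: algebra_simps)
    finally show ?thesis by simp
  qed
  moreover have "E $ 1 $ 1 * E $ 2 $ 3 = E $ 1 $ 2 * E $ 1 $ 3"
  proof -
    have "E $ 1 $ 2 * E $ 1 $ 3 - E $ 1 $ 1 * E $ 2 $ 3 = (E $ 1 $ 2 * E $ 1 $ 3 + E $ 2 $ 2 * E $ 2 $ 3 + E $ 2 $ 3 * E $ 3 $ 3) - E $ 2 $ 3 * ?t"
      by (simp add: algebra_simps)
    also have "\<dots> = 0"
      unfolding t  using eqs unfolding S by (simp add: algebra_simps)
    finally show ?thesis by simp
  qed
  moreover have "E $ 2 $ 2 * E $ 1 $ 3 = E $ 1 $ 2 * E $ 2 $ 3"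
  proof -
    have "E $ 1 $ 2 * E $ 2 $ 3 - E $ 2 $ 2 * E $ 1 $ 3 = (E $ 1 $ 1 * E $ 1 $ 3 + E $ 1 $ 2 * E $ 2 $ 3 + E $ 1 $ 3 * E $ 3 $ 3) - E $ 1 $ 3 * ?t"
      by (simp add: algebra_simps)
    also have "\<dots> = 0"
      unfolding t  using eqs unfolding S by (simp add: algebra_simps)
    finally show ?thesis by simp
  qed
  moreover have "E $ 3 $ 3 * E $ 1 $ 2 = E $ 1 $ 3 * E $ 2 $ 3"
  proof -
    have "E $ 1 $ 3 * E $ 2 $ 3 - E $ 3 $ 3 * E $ 1 $ 2 = (E $ 1 $ 1 * E $ 1 $ 2 + E $ 1 $ 2 * E $ 2 $ 2 + E $ 1 $ 3 * E $ 2 $ 3) - E $ 1 $ 2 * ?t"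
      by (simp add: algebra_simps)
    also have "\<dots> = 0"
      unfolding t  using eqs unfolding S by (simp add: algebra_simps)
    finally show ?thesis by simp
  qed
  ultimately have minors: "\<forall>i j k. E $ k $ k * E $ i $ j = E $ k $ i * E $ k $ j"
    unfolding forall_3 S by (simp add: mult.commute)
  \<comment> \<open>Trace one makes some diagonal entry nonzero; dividing row \<open>k\<close> by a
    complex square root of that entry gives \<open>z\<close>.\<close>
  obtain k where k: "E $ k $ k \<noteq> 0"
    using t by (metis add_0 zero_neq_one)
  define z where "z = (\<chi> i. E $ k $ i / csqrt (E $ k $ k))"
  have cs: "csqrt x * csqrt x = x" for x by (metis power2_csqrt power2_eq_square)
  have z: "E $ i $ j = z $ i * z $ j" for i j
  proof -
    have "E $ k $ k * E $ i $ j = E $ k $ i * E $ k $ j" using minors by blast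
    then have "E $ i $ j = E $ k $ i * E $ k $ j / E $ k $ k"
      using k by (metis nonzero_mult_div_cancel_left)
    then show ?thesis by (simp add: z_def cs)
  qed
  moreover have "cdot z z = 1"
    using t by (simp add: cdot_def sum_3 z)
  ultimately show ?thesis using that by blast
qed

section \<open>Spectral decomposition of the coefficient matrix\<close>

lemma matrix_add_rdistrib: "(A + B) ** C = A ** C + B ** C" for A :: "'a::semiring_1^'n^'m"
  by (simp add: vec_eq_iff matrix_matrix_mult_def distrib_right sum.distrib)

text \<open>By Newton's identities the two trace conditions leave
  \<open>x^3 - (tr (M^2) / 2) x\<close> as characteristic polynomial.\<close>

lemma cayley_hamilton_3:
  fixes M :: "complex^3^3"
  assumes "trace M = 0" "trace (M ** M ** M) = 0"
  shows "M ** M ** M = mat (trace (M ** M) / 2) ** M"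
proof -
  have t: "M $ 1 $ 1 + M $ 2 $ 2 + M $ 3 $ 3 = 0"
    using assms(1) by (simp add: trace_def sum_3)
  note t3 = assms(2)[unfolded trace_def matrix_matrix_mult_def sum_3, simplified]
  have "\<forall>i j. 2 * (M ** M ** M) $ i $ j = trace (M ** M) * M $ i $ j"
    unfolding forall_3 trace_def matrix_matrix_mult_def sum_3 vec_lambda_beta
    using t t3 by (intro conjI; algebra)
  then have "(M ** M ** M) $ i $ j = trace (M ** M) / 2 * M $ i $ j" for i j
    by (simp add: field_simps)
  moreover have "(mat c ** M) $ i $ j = c * M $ i $ j" for c i j
    by (simp add: matrix_matrix_mult_def mat_def if_distrib if_distribR cong: if_cong)
  ultimately show ?thesis by (simp add: vec_eq_iff)
qed

text \<open>The eigenvalues are distinct, so the projectors for the two nonzero ones are polynomials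
  in \<open>M\<close> and inherit its symmetry; having trace one, each is of the form
  \<open>z z^T\<close>.\<close>

lemma symmetric_zero_det_spectral:
  fixes M :: "complex^3^3"
  assumes sym: "transpose M = M" and "trace M = 0" "trace (M ** M ** M) = 0" "trace (M ** M) \<noteq> 0"
  obtains l a b where "2 * l\<^sup>2 = trace (M ** M)" "cdot a a = 1" "cdot b b = 1" "cdot a b = 0"
    "\<And>i j. M $ i $ j = l * (a $ i * a $ j - b $ i * b $ j)"
proof -
  \<comment> \<open>Either square root would serve: changing its sign exchanges \<open>a\<close> and
    \<open>b\<close>.\<close>
  define l where "l = csqrt (trace (M ** M) / 2)"
  have l2: "l\<^sup>2 = trace (M ** M) / 2" by (simp add: l_def)
  then have l: "l \<noteq> 0" using assms(4) by auto
  have cm: "(mat c ** A) $ i $ j = c * A $ i $ j" for c i j and A :: "complex^3^3"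
    by (simp add: matrix_matrix_mult_def mat_def if_distrib if_distribR cong: if_cong)
  have cu: "M ** M ** M = mat (l\<^sup>2) ** M"
    using cayley_hamilton_3[OF assms(2,3)] by (simp only: l2)
  \<comment> \<open>For \<open>c = l\<close> and \<open>c = - l\<close> this is the spectral
    projector \<open>M (M + c) / (2 c^2)\<close> for the eigenvalue \<open>c\<close>.\<close>
  define E where "E c = mat (1 / (2 * c\<^sup>2)) ** (M ** M + mat c ** M)" for c
  have tr: "trace (E c) = 1" if "c\<^sup>2 = l\<^sup>2" for c
  proof -
    have "trace (E c) = (trace (M ** M) + c * trace M) / (2 * c\<^sup>2)"
      by (simp add: E_def trace_def cm sum_distrib_left sum.distrib add_divide_distrib sum_divide_distrib
          distrib_left)
    then show ?thesis using l l2 that assms(2,4) by simp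
  qed
  have "transpose (M ** M) = M ** M" by (simp add: matrix_transpose_mul sym)
  then have tE: "transpose (E c) = E c" for c
    using sym by (simp add: E_def vec_eq_iff transpose_def cm)
  have mM: "M ** (mat c ** A) = mat c ** (M ** A)" for c and A :: "complex^3^3"
    by (simp add: vec_eq_iff cm matrix_matrix_mult_def[of M] sum_distrib_left mult_ac)
  have cuu: "M ** (M ** M) = mat (l\<^sup>2) ** M" using cu by (simp add: matrix_mul_assoc)
  have EM: "M ** E c = mat c ** E c" if "c\<^sup>2 = l\<^sup>2" for c
  proof -
    have "c \<noteq> 0" using that l by auto
    have "M ** E c = mat (1 / (2 * c\<^sup>2)) ** (mat (c\<^sup>2) ** M + mat c ** (M ** M))"
      by (simp add: E_def mM matrix_add_ldistrib cuu that)
    then show ?thesis using \<open>c \<noteq> 0\<close>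
      by (simp add: vec_eq_iff E_def cm power2_eq_square field_simps)
  qed
  \<comment> \<open>The case \<open>d = c\<close> gives idempotence, the case \<open>d = - c\<close>
    the orthogonality of the two projectors.\<close>
  have comb: "E d ** E c = mat ((c\<^sup>2 + d * c) / (2 * d\<^sup>2)) ** E c" if "c\<^sup>2 = l\<^sup>2" for c d
  proof -
    have "E d ** E c = mat (1 / (2 * d\<^sup>2)) ** (M ** (M ** E c) + mat d ** (M ** E c))"
      by (simp add: E_def[of d] matrix_add_rdistrib flip: matrix_mul_assoc)
    then show ?thesis
      by (simp add: EM[OF that] mM)
        (simp add: vec_eq_iff cm power2_eq_square field_simps add_divide_distrib)
  qed
  have idem: "E c ** E c = E c" if "c\<^sup>2 = l\<^sup>2" for c
  proof -
    have "c \<noteq> 0" using that l by auto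
    then show ?thesis using comb[OF that, of c]
      by (simp add: power2_eq_square)
  qed
  obtain a where a: "\<And>i j. E l $ i $ j = a $ i * a $ j" "cdot a a = 1"
    using idempotent_symmetric_trace_one[OF tE idem tr] by metis
  obtain b where b: "\<And>i j. E (- l) $ i $ j = b $ i * b $ j" "cdot b b = 1"
    using idempotent_symmetric_trace_one[OF tE idem tr, of "- l"] by (metis power2_minus)
  have "E (- l) ** E l = 0"
    using comb[of l "- l"] by (simp add: power2_eq_square)
  moreover have "(E (- l) ** E l) $ i $ j = b $ i * a $ j * cdot a b" for i j
    unfolding matrix_matrix_mult_def vec_lambda_beta a b cdot_def sum_3 by (simp add: algebra_simps)
  ultimately have "b $ i * a $ j * cdot a b = 0" for i j
    by (metis zero_index)
  then have "cdot b b * cdot a a * cdot a b = 0"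
    by (metis (no_types, lifting) a(2) b(2) cdot_def mult_eq_0_iff sum.neutral mult_1 zero_neq_one)
  then have "cdot a b = 0" using a b by simp
  moreover have "M $ i $ j = l * (a $ i * a $ j - b $ i * b $ j)" for i j
    unfolding a(1)[symmetric] b(1)[symmetric] using l
    by (simp add: E_def cm field_simps power2_eq_square)
  moreover have "2 * l\<^sup>2 = trace (M ** M)" unfolding l2 by simp
  ultimately show ?thesis using that a(2) b(2) by blast
qed

section \<open>The Bel-Robinson tensor\<close>

text \<open>A Kronecker product applied to a column amounts to a two-sided product once the column
  is read as a matrix.\<close>

lemma kron_transpose_mult_nth:
  "(transpose (kron X Y) ** F) $ (\<alpha>, \<beta>) $ i = (transpose X ** (\<chi> a b. F $ (a, b) $ i) ** Y) $ \<alpha> $ \<beta>"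
  for X :: "'a::comm_semiring_1^'n^'m"
proof -
  have "(transpose (kron X Y) ** F) $ (\<alpha>, \<beta>) $ i = (\<Sum>a\<in>UNIV. \<Sum>b\<in>UNIV. X $ a $ \<alpha> * F $ (a, b) $ i * Y $ b $ \<beta>)"
    by (simp add: matrix_matrix_mult_def transpose_def sum_prod_UNIV mult_ac)
  also have "\<dots> = (\<Sum>b\<in>UNIV. \<Sum>a\<in>UNIV. X $ a $ \<alpha> * F $ (a, b) $ i * Y $ b $ \<beta>)"
    by (rule sum.swap)
  finally show ?thesis
    by (simp add: matrix_matrix_mult_def transpose_def sum_distrib_right)
qed

lemma transpose_mult_nth: "(transpose C ** F) $ p $ q = (\<Sum>r\<in>UNIV. C $ r $ p * F $ r $ q)"
  by (simp add: matrix_matrix_mult_def transpose_def)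

lemma congruence_nth:
  "(X ** S ** transpose Y) $ p $ q = (\<Sum>r\<in>UNIV. \<Sum>u\<in>UNIV. X $ p $ u * S $ u $ r * Y $ q $ r)"
  by (simp add: matrix_matrix_mult_def transpose_def sum_distrib_right)

text \<open>The counterpart of \<open>sdcol\<close> for symmetric traceless tensors, with one column
  for each pair of a basis self-dual and a basis anti-self-dual bivector.\<close>

definition hermcol :: "complex^(3 \<times> 3)^(4 \<times> 4)" where
  "hermcol = (\<chi> p q. herm (axis (fst q) 1) (axis (snd q) 1) $ fst p $ snd p)"

lemma hermcol_nth [simp]:
  "hermcol $ (a, b) $ (i, k) = herm (axis i 1) (axis k 1) $ a $ b"
  by (simp add: hermcol_def)

lemma herm_sym: "transpose (herm z w) = herm z w"
  unfolding herm_explicit by (simp add: vec_eq_iff forall_4 transpose_def)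

lemma cdot_axis: "cdot (axis i 1) (axis j 1) = (if i = j then 1 else 0)"
proof -
  have "\<forall>i j. cdot (axis i 1) (axis j 1) = (if i = j then 1 else 0)"
    unfolding forall_3 cdot_def sum_3 by (simp add: axis_def)
  then show ?thesis by blast
qed

text \<open>Orthogonality of these columns, by \<open>herm_gram\<close>. The scalar 4 is the source
  of the powers of 4 in the traces of powers of \<open>T\<close>.\<close>

lemma hermcol_gram: "transpose hermcol ** kron eta eta ** hermcol = mat 4"
proof -
  have eta_sym: "transpose eta = eta"
    by (auto simp: vec_eq_iff transpose_def eta_nth)
  have "(transpose hermcol ** (transpose (kron eta eta) ** hermcol)) $ (i, k) $ (j, l) = mat 4 $ (i, k) $ (j, l)" for i j k l
  proof -
    let ?h = "herm (axis i 1) (axis k 1)" and ?h' = "herm (axis j 1) (axis l 1)"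
    have "(transpose hermcol ** (transpose (kron eta eta) ** hermcol)) $ (i, k) $ (j, l)
        = (\<Sum>a\<in>UNIV. \<Sum>b\<in>UNIV. ?h $ a $ b * (transpose eta ** ?h' ** eta) $ a $ b)"
      by (simp add: transpose_mult_nth[of hermcol] sum_prod_UNIV kron_transpose_mult_nth vec_lambda_eta)
    also have "\<dots> = trace (transpose ?h ** (transpose eta ** ?h' ** eta))"
      unfolding trace_def transpose_mult_nth by (rule sum.swap)
    also have "\<dots> = trace (eta ** ?h ** eta ** ?h')"
      using trace_mul_sym[of "?h ** eta ** ?h'" eta] by (simp add: herm_sym eta_sym matrix_mul_assoc)
    also have "\<dots> = 4 * cdot (axis i 1) (axis j 1) * cnj (cdot (axis k 1) (axis l 1))"
      by (rule herm_gram)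
    also have "\<dots> = mat 4 $ (i, k) $ (j, l)"
      by (auto simp: cdot_axis mat_def)
    finally show ?thesis .
  qed
  then show ?thesis
    by (simp add: vec_eq_iff kron_transpose eta_sym matrix_mul_assoc)
qed

lemma herm_sum:
  "herm z w $ a $ b = (\<Sum>i\<in>UNIV. \<Sum>k\<in>UNIV. herm (axis i 1) (axis k 1) $ a $ b * (z $ i * cnj (w $ k)))"
proof -
  have "\<forall>a b. herm z w $ a $ b = (\<Sum>i\<in>UNIV. \<Sum>k\<in>UNIV. herm (axis i 1) (axis k 1) $ a $ b * (z $ i * cnj (w $ k)))"
    unfolding herm_explicit forall_4 sum_3
    by (intro conjI; simp add: axis_def; simp add: algebra_simps)
  then show ?thesis by blast
qed

text \<open>The contraction joins a bivector of one factor to the conjugate of a bivector of the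
  other, and each such product is a column of \<open>hermcol\<close>. The coefficients left over are
  \<open>kron M (cnjm M)\<close>.\<close>

lemma bel_robinson_decomposition:
  assumes AB: "B ** A = mat 1"
    and inv: "matrix_inv g = A ** minkowski ** transpose A"
  defines "K \<equiv> transpose (kron (cmat B) (cmat B))"
  assumes M: "mat4 (self_dual_weyl g s W) = (K ** sdcol) ** M ** transpose (K ** sdcol)"
  shows "cmat (mat4 (bel_robinson g s W)) = (K ** hermcol) ** kron M (cnjm M) ** transpose (K ** hermcol)"
proof -
  define w where "w = self_dual_weyl g s W"
  define H where "H = cmat (matrix_inv g)"
  \<comment> \<open>\<open>R \<alpha>\<close> lists the three basis bivectors with their first index
    fixed at \<alpha>.\<close>
  define R :: "4 \<Rightarrow> complex^4^3" where "R \<alpha> = (\<chi> i \<kappa>. (K ** sdcol) $ (\<alpha>, \<kappa>) $ i)" for \<alpha>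
  have H: "H = cmat A ** eta ** transpose (cmat A)"
    by (simp add: H_def inv cmat_mult cmat_transpose eta_def)
  have HT: "transpose H = H"
    unfolding H_def by (simp add: inv flip: cmat_transpose) (simp add: matrix_transpose_mul transpose_minkowski matrix_mul_assoc)
  have Hsym: "H $ i $ j = H $ j $ i" for i j
    using HT by (auto simp: vec_eq_iff transpose_def)
  have BA: "cmat B ** cmat A = mat 1" "transpose (cmat A) ** transpose (cmat B) = mat 1"
    using AB by (metis cmat_mult cmat_one) (metis AB cmat_mult cmat_one matrix_transpose_mul transpose_mat)
  have N: "(K ** hermcol) $ (\<alpha>, \<mu>) $ (i, k) = (R \<alpha> ** H ** transpose (cnjm (R \<mu>))) $ i $ k" for \<alpha> \<mu> i k
  proof -
    define S where "S i = transpose (cmat B) ** sd (axis i 1) ** cmat B" for i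
    have R: "R \<alpha> $ i $ \<kappa> = S i $ \<alpha> $ \<kappa>" for \<alpha> i \<kappa>
      by (simp add: R_def K_def kron_transpose_mult_nth S_def vec_lambda_eta)
    have "(R \<alpha> ** H ** transpose (cnjm (R \<mu>))) $ i $ k = (S i ** H ** transpose (cnjm (S k))) $ \<alpha> $ \<mu>"
      by (simp add: matrix_matrix_mult_def transpose_def R)
    moreover have "S i ** H ** transpose (cnjm (S k)) = transpose (cmat B) ** sd (axis i 1) ** (cmat B ** cmat A) ** eta
       ** (transpose (cmat A) ** transpose (cmat B)) ** transpose (cnjm (sd (axis k 1))) ** cmat B"
      by (simp add: S_def H matrix_transpose_mul cnjm_mult cnjm_transpose cnjm_cmat matrix_mul_assoc)
    ultimately show ?thesis
      by (simp add: BA herm_def K_def kron_transpose_mult_nth vec_lambda_eta matrix_mul_assoc)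
  qed
  have w: "w \<alpha> \<kappa> \<beta> \<tau> = (transpose (R \<alpha>) ** M ** R \<beta>) $ \<kappa> $ \<tau>" for \<alpha> \<beta> \<kappa> \<tau>
  proof -
    have "w \<alpha> \<kappa> \<beta> \<tau> = mat4 w $ (\<alpha>, \<kappa>) $ (\<beta>, \<tau>)" by simp
    also have "\<dots> = (transpose (R \<alpha>) ** M ** R \<beta>) $ \<kappa> $ \<tau>"
      unfolding w_def M by (simp add: matrix_matrix_mult_def transpose_def R_def)
    finally show ?thesis .
  qed
  have reorder: "(\<Sum>k\<in>UNIV. \<Sum>l\<in>UNIV. \<Sum>j\<in>UNIV. \<Sum>i\<in>UNIV. f i j k l) = (\<Sum>j\<in>UNIV. \<Sum>l\<in>UNIV. \<Sum>i\<in>UNIV. \<Sum>k\<in>UNIV. f i j k l)"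
    for f :: "3 \<Rightarrow> 3 \<Rightarrow> 3 \<Rightarrow> 3 \<Rightarrow> complex"
    by (rule trans[OF sum.cong[OF refl sum.swap]], rule trans[OF sum.swap], rule sum.cong[OF refl],
        rule trans[OF sum.swap], rule sum.cong[OF refl], rule sum.swap)
  define Z where "Z \<alpha> \<mu> \<beta> \<nu> = (\<Sum>\<rho>\<in>UNIV. \<Sum>\<sigma>\<in>UNIV. \<Sum>\<kappa>\<in>UNIV. \<Sum>\<tau>\<in>UNIV.
        complex_of_real (ginv g \<rho> \<kappa> * ginv g \<sigma> \<tau>) * w \<alpha> \<kappa> \<beta> \<tau> * cnj (w \<mu> \<rho> \<nu> \<sigma>))" for \<alpha> \<mu> \<beta> \<nu>
  have Z: "Z \<alpha> \<mu> \<beta> \<nu> = ((K ** hermcol) ** kron M (cnjm M) ** transpose (K ** hermcol)) $ (\<alpha>, \<mu>) $ (\<beta>, \<nu>)" for \<alpha> \<mu> \<beta> \<nu>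
  proof -
    define Y where "Y = transpose (R \<alpha>) ** M ** R \<beta>"
    define Y' where "Y' = cnjm (transpose (R \<mu>) ** M ** R \<nu>)"
    define N1 where "N1 = R \<alpha> ** H ** transpose (cnjm (R \<mu>))"
    define N2 where "N2 = R \<beta> ** H ** transpose (cnjm (R \<nu>))"
    have "Z \<alpha> \<mu> \<beta> \<nu> = (\<Sum>\<rho>\<in>UNIV. \<Sum>\<sigma>\<in>UNIV. \<Sum>\<kappa>\<in>UNIV. \<Sum>\<tau>\<in>UNIV. H $ \<rho> $ \<kappa> * Y $ \<kappa> $ \<tau> * H $ \<sigma> $ \<tau> * Y' $ \<rho> $ \<sigma>)"
      unfolding Z_def w Y_def Y'_def by (simp add: H_def ginv_def mult_ac)
    also have "\<dots> = (\<Sum>\<rho>\<in>UNIV. \<Sum>\<sigma>\<in>UNIV. \<Sum>\<tau>\<in>UNIV. \<Sum>\<kappa>\<in>UNIV. H $ \<rho> $ \<kappa> * Y $ \<kappa> $ \<tau> * H $ \<sigma> $ \<tau> * Y' $ \<rho> $ \<sigma>)"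
      by (rule sum.cong[OF refl], rule sum.cong[OF refl], rule sum.swap)
    \<comment> \<open>Written as a trace, the contraction can be rotated cyclically until its
      factors combine into \<open>N1\<close> and \<open>N2\<close>.\<close>
    also have "\<dots> = trace (H ** Y ** transpose H ** transpose Y')"
      by (simp add: trace_def matrix_matrix_mult_def transpose_def sum_distrib_right)
    also have "\<dots> = trace ((H ** transpose (R \<alpha>) ** M ** N2 ** transpose (cnjm M)) ** cnjm (R \<mu>))"
      unfolding HT Y_def Y'_def N2_def
      by (simp add: cnjm_mult cnjm_transpose matrix_transpose_mul matrix_mul_assoc)
    also have "\<dots> = trace (cnjm (R \<mu>) ** (H ** transpose (R \<alpha>) ** M ** N2 ** transpose (cnjm M)))"
      by (rule trace_mul_sym)
    also have "\<dots> = trace (transpose N1 ** M ** N2 ** transpose (cnjm M))"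
      by (simp add: N1_def matrix_transpose_mul HT matrix_mul_assoc)
    also have "\<dots> = (\<Sum>k\<in>UNIV. \<Sum>l\<in>UNIV. \<Sum>j\<in>UNIV. \<Sum>i\<in>UNIV. N1 $ i $ k * (M $ i $ j * cnjm M $ k $ l) * N2 $ j $ l)"
      by (simp add: trace_def matrix_matrix_mult_def transpose_def sum_distrib_left sum_distrib_right mult_ac)
    also have "\<dots> = (\<Sum>j\<in>UNIV. \<Sum>l\<in>UNIV. \<Sum>i\<in>UNIV. \<Sum>k\<in>UNIV. N1 $ i $ k * (M $ i $ j * cnjm M $ k $ l) * N2 $ j $ l)"
      by (rule reorder)
    also have "\<dots> = ((K ** hermcol) ** kron M (cnjm M) ** transpose (K ** hermcol)) $ (\<alpha>, \<mu>) $ (\<beta>, \<nu>)"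
      unfolding congruence_nth sum_prod_UNIV N N1_def N2_def by simp
    finally show ?thesis .
  qed
  \<comment> \<open>What follows shows that the sum is real: conjugation exchanges the roles of
    \<alpha>, \<beta> and \<mu>, \<nu>, and the symmetry of the columns undoes this. So the real
    part in \<open>bel_robinson\<close> loses nothing.\<close>
  have sym: "(K ** hermcol) $ (\<mu>, \<alpha>) = (K ** hermcol) $ (\<alpha>, \<mu>)" for \<alpha> \<mu>
  proof -
    have "transpose (transpose (cmat B) ** herm z w ** cmat B) = transpose (cmat B) ** herm z w ** cmat B" for z w
      by (simp add: matrix_transpose_mul herm_sym matrix_mul_assoc)
    then have "(transpose (cmat B) ** herm z w ** cmat B) $ \<mu> $ \<alpha> = (transpose (cmat B) ** herm z w ** cmat B) $ \<alpha> $ \<mu>" for z w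
      by (metis (no_types, lifting) transpose_def vec_lambda_beta)
    then show ?thesis
      by (simp add: vec_eq_iff K_def kron_transpose_mult_nth vec_lambda_eta)
  qed
  have "Z \<mu> \<alpha> \<nu> \<beta> = Z \<alpha> \<mu> \<beta> \<nu>" for \<alpha> \<mu> \<beta> \<nu>
    unfolding Z congruence_nth by (simp only: sym)
  moreover have "cnj (Z \<alpha> \<mu> \<beta> \<nu>) = Z \<mu> \<alpha> \<nu> \<beta>" for \<alpha> \<mu> \<beta> \<nu>
  proof -
    define G where "G \<rho> \<sigma> \<kappa> \<tau> = H $ \<rho> $ \<kappa> * H $ \<sigma> $ \<tau> * w \<mu> \<kappa> \<nu> \<tau> * cnj (w \<alpha> \<rho> \<beta> \<sigma>)" for \<rho> \<sigma> \<kappa> \<tau>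
    have Hg: "complex_of_real (ginv g i j) = H $ i $ j" for i j
      by (simp add: H_def ginv_def)
    have Hc: "cnj (H $ i $ j) = H $ j $ i" for i j
    proof -
      have "cnj (H $ i $ j) = H $ i $ j" by (simp add: H_def)
      then show ?thesis by (simp add: Hsym[of i j])
    qed
    have "cnj (Z \<alpha> \<mu> \<beta> \<nu>) = (\<Sum>\<rho>\<in>UNIV. \<Sum>\<sigma>\<in>UNIV. \<Sum>\<kappa>\<in>UNIV. \<Sum>\<tau>\<in>UNIV. G \<kappa> \<tau> \<rho> \<sigma>)"
      unfolding Z_def G_def of_real_mult Hg by (simp add: Hc mult_ac)
    also have "\<dots> = (\<Sum>p\<in>UNIV. \<Sum>q\<in>UNIV. G (fst q) (snd q) (fst p) (snd p))"
      by (simp add: sum_prod_UNIV)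
    also have "\<dots> = (\<Sum>q\<in>UNIV. \<Sum>p\<in>UNIV. G (fst q) (snd q) (fst p) (snd p))"
      by (rule sum.swap)
    also have "\<dots> = Z \<mu> \<alpha> \<nu> \<beta>"
      unfolding Z_def G_def of_real_mult Hg by (simp add: sum_prod_UNIV)
    finally show ?thesis .
  qed
  ultimately have "cnj (Z \<alpha> \<mu> \<beta> \<nu>) = Z \<alpha> \<mu> \<beta> \<nu>" for \<alpha> \<mu> \<beta> \<nu>
    by simp
  then have "complex_of_real (bel_robinson g s W \<alpha> \<mu> \<beta> \<nu>) = Z \<alpha> \<mu> \<beta> \<nu>" for \<alpha> \<mu> \<beta> \<nu>
    unfolding bel_robinson_def w_def[symmetric] Z_def[symmetric]
    by (metis Reals_cnj_iff of_real_Re)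
  then show ?thesis
    by (simp add: vec_eq_iff Z)
qed

section \<open>Tensors built from two commuting involutions\<close>

lemma sum_factor_12_34:
  "(\<Sum>i\<in>UNIV. \<Sum>j\<in>UNIV. \<Sum>m\<in>UNIV. \<Sum>n\<in>UNIV. f i j * h m n)
     = (\<Sum>i\<in>UNIV. \<Sum>j\<in>UNIV. f i j) * (\<Sum>m\<in>UNIV. \<Sum>n\<in>UNIV. h m n)"
  for f h :: "'a::finite \<Rightarrow> 'a \<Rightarrow> 'b::comm_semiring_1"
  by (simp add: sum_distrib_right) (simp add: sum_distrib_left)

lemma sum_factor_13_24:
  "(\<Sum>i\<in>UNIV. \<Sum>j\<in>UNIV. \<Sum>m\<in>UNIV. \<Sum>n\<in>UNIV. f i m * h j n)
     = (\<Sum>i\<in>UNIV. \<Sum>m\<in>UNIV. f i m) * (\<Sum>j\<in>UNIV. \<Sum>n\<in>UNIV. h j n)"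
  for f h :: "'a::finite \<Rightarrow> 'a \<Rightarrow> 'b::comm_semiring_1"
  unfolding sum_factor_12_34[symmetric] by (rule sum.cong[OF refl], rule sum.swap)

lemma sum_factor_14_23:
  "(\<Sum>i\<in>UNIV. \<Sum>j\<in>UNIV. \<Sum>m\<in>UNIV. \<Sum>n\<in>UNIV. f i n * h j m)
     = (\<Sum>i\<in>UNIV. \<Sum>n\<in>UNIV. f i n) * (\<Sum>j\<in>UNIV. \<Sum>m\<in>UNIV. h j m)"
  for f h :: "'a::finite \<Rightarrow> 'a \<Rightarrow> 'b::comm_semiring_1"
  unfolding sum_factor_13_24[symmetric]
  by (rule sum.cong[OF refl], rule sum.cong[OF refl], rule sum.swap)

lemma sum2_linear:
  "(\<Sum>i\<in>I. \<Sum>j\<in>J. x * f i j + y * h i j) = x * (\<Sum>i\<in>I. \<Sum>j\<in>J. f i j) + y * (\<Sum>i\<in>I. \<Sum>j\<in>J. h i j)"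
  for x y :: "'a::semiring_0"
  by (simp add: sum.distrib sum_distrib_left)

lemma matrix_mult3_nth:
  "(X ** Y ** Z) $ a $ b = (\<Sum>k\<in>UNIV. \<Sum>r\<in>UNIV. X $ a $ r * Y $ r $ k * Z $ k $ b)"
  by (simp add: matrix_matrix_mult_def sum_distrib_right)

lemma matrix_mult3_nth':
  "(X ** Y ** Z) $ a $ b = (\<Sum>r\<in>UNIV. \<Sum>k\<in>UNIV. X $ a $ r * Y $ r $ k * Z $ k $ b)"
  unfolding matrix_mult3_nth by (rule sum.swap)

lemma quadratic_form_sum: "u \<bullet> (p *v u) = (\<Sum>\<alpha>\<in>UNIV. \<Sum>\<beta>\<in>UNIV. p $ \<alpha> $ \<beta> * (u $ \<alpha> * u $ \<beta>))"
  for u :: "real^'n"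
  by (simp add: inner_vec_def matrix_vector_mult_def sum_distrib_left mult_ac)

lemma timelike_iff: "timelike g u \<longleftrightarrow> u \<bullet> (g *v u) < 0"
  by (simp add: timelike_def quadratic_form_sum mult_ac)

text \<open>Half of \<open>wedge p p\<close>.\<close>

definition minor2 :: "'a::ring^4^4 \<Rightarrow> 4 \<Rightarrow> 4 \<Rightarrow> 4 \<Rightarrow> 4 \<Rightarrow> 'a" where
  "minor2 p \<alpha> \<beta> \<mu> \<nu> = p $ \<alpha> $ \<mu> * p $ \<beta> $ \<nu> - p $ \<alpha> $ \<nu> * p $ \<beta> $ \<mu>"

context
  fixes g pa pb :: "real^4^4" and P :: "real tensor4" and u :: "real^4"
  assumes sym: "transpose pa = pa" "transpose pb = pb" "transpose (matrix_inv g) = matrix_inv g"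
    and sq: "pa ** matrix_inv g ** pa = g" "pb ** matrix_inv g ** pb = g"
    and comm: "pb ** matrix_inv g ** pa = pa ** matrix_inv g ** pb"
    and inv: "g ** matrix_inv g = mat 1" "matrix_inv g ** g = mat 1"
    and P: "\<And>\<alpha> \<beta> \<mu> \<nu>. P \<alpha> \<beta> \<mu> \<nu> = (pa $ \<alpha> $ \<beta> * pa $ \<mu> $ \<nu> + pb $ \<alpha> $ \<beta> * pb $ \<mu> $ \<nu>) / 4"
begin

private abbreviation "H \<equiv> matrix_inv g"
private abbreviation "pc \<equiv> pa ** matrix_inv g ** pb"

text \<open>The two squares contribute multiples of the metric, which the last term of
  \<open>V\<close> cancels exactly; by commutativity both mixed products equal
  \<open>pc\<close>.\<close>

lemma V_tensor_structure: "V_tensor g P \<alpha> \<beta> \<mu> \<nu> = pc $ \<alpha> $ \<beta> * pc $ \<mu> $ \<nu> / 4"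
proof -
  have s: "pa $ i $ j = pa $ j $ i" "pb $ i $ j = pb $ j $ i" for i j
    using sym by (auto simp: vec_eq_iff transpose_def)
  define f where "f x y \<alpha> \<beta> \<rho> \<kappa> = x $ \<alpha> $ \<rho> * H $ \<rho> $ \<kappa> * y $ \<kappa> $ \<beta>" for x y :: "real^4^4" and \<alpha> \<beta> \<rho> \<kappa>
  have f: "(\<Sum>\<rho>\<in>UNIV. \<Sum>\<kappa>\<in>UNIV. f x y \<alpha> \<beta> \<rho> \<kappa>) = (x ** H ** y) $ \<alpha> $ \<beta>" for x y \<alpha> \<beta>
    by (simp add: matrix_mult3_nth' f_def)
  have PP: "P \<alpha> \<rho> \<mu> \<sigma> * ginv g \<rho> \<kappa> * ginv g \<sigma> \<tau> * P \<beta> \<kappa> \<nu> \<tau>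
    = (f pa pa \<alpha> \<beta> \<rho> \<kappa> * f pa pa \<mu> \<nu> \<sigma> \<tau> + f pa pb \<alpha> \<beta> \<rho> \<kappa> * f pa pb \<mu> \<nu> \<sigma> \<tau>
      + f pb pa \<alpha> \<beta> \<rho> \<kappa> * f pb pa \<mu> \<nu> \<sigma> \<tau> + f pb pb \<alpha> \<beta> \<rho> \<kappa> * f pb pb \<mu> \<nu> \<sigma> \<tau>) / 16" for \<rho> \<sigma> \<kappa> \<tau>
    unfolding P f_def ginv_def s[of \<kappa> \<beta>] s[of \<tau> \<nu>] by (simp add: field_simps)
  have "(\<Sum>\<rho>\<in>UNIV. \<Sum>\<sigma>\<in>UNIV. \<Sum>\<kappa>\<in>UNIV. \<Sum>\<tau>\<in>UNIV. P \<alpha> \<rho> \<mu> \<sigma> * ginv g \<rho> \<kappa> * ginv g \<sigma> \<tau> * P \<beta> \<kappa> \<nu> \<tau>)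
    = ((pa ** H ** pa) $ \<alpha> $ \<beta> * (pa ** H ** pa) $ \<mu> $ \<nu> + (pa ** H ** pb) $ \<alpha> $ \<beta> * (pa ** H ** pb) $ \<mu> $ \<nu>
      + (pb ** H ** pa) $ \<alpha> $ \<beta> * (pb ** H ** pa) $ \<mu> $ \<nu> + (pb ** H ** pb) $ \<alpha> $ \<beta> * (pb ** H ** pb) $ \<mu> $ \<nu>) / 16"
    by (simp only: PP sum.distrib sum_divide_distrib[symmetric] sum_factor_13_24 f)
  then show ?thesis
    unfolding V_tensor_def by (simp add: sq comm)
qed

lemma quad4_V_tensor: "quad4 (V_tensor g P) (sq_tensor u) = (u \<bullet> (pc *v u))\<^sup>2 / 4"
proof -
  have "quad4 (V_tensor g P) (sq_tensor u) = (\<Sum>\<alpha>\<in>UNIV. \<Sum>\<beta>\<in>UNIV. \<Sum>\<mu>\<in>UNIV. \<Sum>\<nu>\<in>UNIV.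
      (pc $ \<alpha> $ \<beta> * (u $ \<alpha> * u $ \<beta>)) * (pc $ \<mu> $ \<nu> * (u $ \<mu> * u $ \<nu>))) / 4"
    by (simp add: quad4_def V_tensor_structure sq_tensor_def sum_divide_distrib mult_ac)
  then show ?thesis
    by (simp only: sum_factor_12_34 quadratic_form_sum power2_eq_square)
qed

text \<open>The minus sign arises because the root of the squared value of \<open>pc\<close> at
  \<open>u\<close> is its absolute value.\<close>

lemma Pi1_structure:
  assumes neg: "u \<bullet> (pc *v u) < 0"
  shows "Pi1 (V_tensor g P) (sq_tensor u) \<alpha> \<beta> = - pc $ \<alpha> $ \<beta> / 2"
proof -
  have "app4 (V_tensor g P) (sq_tensor u) \<alpha> \<beta> = pc $ \<alpha> $ \<beta> * (u \<bullet> (pc *v u)) / 4"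
    by (simp add: app4_def V_tensor_structure sq_tensor_def quadratic_form_sum sum_distrib_left
        sum_divide_distrib mult_ac)
  moreover have "sqrt (quad4 (V_tensor g P) (sq_tensor u)) = - (u \<bullet> (pc *v u)) / 2"
    using neg by (simp add: quad4_V_tensor real_sqrt_divide)
  ultimately have "Pi1 (V_tensor g P) (sq_tensor u) \<alpha> \<beta>
      = (pc $ \<alpha> $ \<beta> * (u \<bullet> (pc *v u)) / 4) / (- (u \<bullet> (pc *v u)) / 2)"
    by (simp only: Pi1_def)
  then show ?thesis
    using neg by (simp add: field_simps)
qed

text \<open>Because of the factor \<open>1/2\<close> in \<open>Pi1_structure\<close>, the condition \<open>\<Pi>\<^sub>1(u) \<noteq> u\<close> holds for every
  time-like \<open>u\<close>.\<close>

lemma act_vec_Pi1: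
  assumes neg: "u \<bullet> (pc *v u) < 0"
  shows "act_vec g (Pi1 (V_tensor g P) (sq_tensor u)) u \<noteq> u"
proof
  assume "act_vec g (Pi1 (V_tensor g P) (sq_tensor u)) u = u"
  moreover have "act_vec g (Pi1 (V_tensor g P) (sq_tensor u)) u = (- 1/2) *\<^sub>R (H ** pc *v u)"
  proof -
    have "(H ** pc *v u) $ \<alpha> = (\<Sum>\<beta>\<in>UNIV. \<Sum>\<kappa>\<in>UNIV. H $ \<alpha> $ \<kappa> * pc $ \<kappa> $ \<beta> * u $ \<beta>)" for \<alpha>
      by (simp add: matrix_vector_mult_def matrix_matrix_mult_def[of H] sum_distrib_right)
    then show ?thesis
      by (simp add: vec_eq_iff act_vec_def Pi1_structure[OF neg] ginv_def sum_negf flip: sum_divide_distrib)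
  qed
  ultimately have e: "u = (- 1/2) *\<^sub>R (H ** pc *v u)" by simp
  \<comment> \<open>\<open>H ** pc\<close> is again an involution, so it cannot have the eigenvalue
    -2 that the assumed equation requires.\<close>
  have "pc ** H ** pc = pa ** H ** (pb ** H ** pa) ** H ** pb"
    by (simp add: matrix_mul_assoc)
  also have "\<dots> = (pa ** H ** pa) ** H ** (pb ** H ** pb)"
    unfolding comm by (simp add: matrix_mul_assoc)
  also have "\<dots> = g" by (simp add: sq inv)
  finally have "(H ** pc) ** (H ** pc) = mat 1"
    using inv by (metis matrix_mul_assoc)
  then have "H ** pc *v (H ** pc *v u) = u"
    by (simp add: matrix_vector_mul_assoc)
  moreover have "H ** pc *v (H ** pc *v u) = 4 *\<^sub>R u"
  proof -
    have h: "H ** pc *v u = (- 2) *\<^sub>R u" by (subst (2) e) simp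
    show ?thesis unfolding h matrix_vector_mult_scaleR by simp
  qed
  ultimately have "4 *\<^sub>R u = u" by simp
  then have "u = 0" by (simp add: vec_eq_iff)
  then show False using neg by simp
qed

text \<open>Multiplication by \<open>pc\<close> exchanges \<open>pa\<close> and \<open>pb\<close>,
  so \<open>Q\<close> has mixed products where \<open>P\<close> has squares.\<close>

lemma Q_tensor_structure:
  assumes neg: "u \<bullet> (pc *v u) < 0"
  shows "Q_tensor g (Pi1 (V_tensor g P) (sq_tensor u)) P \<alpha> \<beta> \<mu> \<nu>
    = - (pb $ \<alpha> $ \<beta> * pa $ \<mu> $ \<nu> + pa $ \<alpha> $ \<beta> * pb $ \<mu> $ \<nu>) / 4"
proof -
  have ba: "pc ** H ** pa = pb"
  proof -
    have "pc ** H ** pa = pa ** H ** (pb ** H ** pa)" by (simp add: matrix_mul_assoc)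
    also have "\<dots> = (pa ** H ** pa) ** H ** pb" unfolding comm by (simp add: matrix_mul_assoc)
    finally show ?thesis by (simp add: sq inv)
  qed
  have bb: "pc ** H ** pb = pa"
  proof -
    have "pc ** H ** pb = pa ** H ** (pb ** H ** pb)" by (simp add: matrix_mul_assoc)
    also have "\<dots> = pa ** (H ** g)" unfolding sq by (simp add: matrix_mul_assoc)
    finally show ?thesis by (simp add: inv)
  qed
  have "Q_tensor g (Pi1 (V_tensor g P) (sq_tensor u)) P \<alpha> \<beta> \<mu> \<nu>
     = 2 * (\<Sum>\<rho>\<in>UNIV. \<Sum>\<kappa>\<in>UNIV. (- pa $ \<mu> $ \<nu> / 8) * (pc $ \<alpha> $ \<kappa> * H $ \<kappa> $ \<rho> * pa $ \<rho> $ \<beta>)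
        + (- pb $ \<mu> $ \<nu> / 8) * (pc $ \<alpha> $ \<kappa> * H $ \<kappa> $ \<rho> * pb $ \<rho> $ \<beta>))"
    unfolding Q_tensor_def act4_def Pi1_structure[OF neg] P ginv_def
    by (intro arg_cong[of _ _ "\<lambda>x. 2 * x"] sum.cong refl) (simp add: field_simps)
  also have "\<dots> = - ((pc ** H ** pa) $ \<alpha> $ \<beta> * pa $ \<mu> $ \<nu> + (pc ** H ** pb) $ \<alpha> $ \<beta> * pb $ \<mu> $ \<nu>) / 4"
    unfolding sum2_linear matrix_mult3_nth[of pc] by (simp add: field_simps)
  finally show ?thesis by (simp add: ba bb)
qed

text \<open>Up to the factor 1/4, \<open>P(X)\<close> is \<open>a pa + b pb\<close> and
  \<open>Q(X)\<close> is \<open>- (a pb + b pa)\<close>. In the difference of the wedges the mixed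
  terms cancel, and the radicand is a perfect square, so \<open>u\<close> influences the quotient
  only through a sign.\<close>

lemma W0_structure:
  assumes neg: "u \<bullet> (pc *v u) < 0"
  defines "a \<equiv> u \<bullet> (pa *v u)" and "b \<equiv> u \<bullet> (pb *v u)"
  defines "Q \<equiv> Q_tensor g (Pi1 (V_tensor g P) (sq_tensor u)) P"
  shows "W0_radicand P Q (sq_tensor u) = (a\<^sup>2 - b\<^sup>2)\<^sup>2 / 16"
    and "W0_tensor t P Q (sq_tensor u) \<alpha> \<beta> \<mu> \<nu>
      = sqrt t / 2 * sgn (a\<^sup>2 - b\<^sup>2) * (minor2 pa \<alpha> \<beta> \<mu> \<nu> - minor2 pb \<alpha> \<beta> \<mu> \<nu>)"
proof -
  have Q: "Q \<alpha> \<beta> \<mu> \<nu> = - (pb $ \<alpha> $ \<beta> * pa $ \<mu> $ \<nu> + pa $ \<alpha> $ \<beta> * pb $ \<mu> $ \<nu>) / 4" for \<alpha> \<beta> \<mu> \<nu>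
    unfolding Q_def by (rule Q_tensor_structure[OF neg])
  have appP: "app4 P (sq_tensor u) \<alpha> \<beta> = (a * pa $ \<alpha> $ \<beta> + b * pb $ \<alpha> $ \<beta>) / 4" for \<alpha> \<beta>
  proof -
    have "app4 P (sq_tensor u) \<alpha> \<beta> = (\<Sum>\<mu>\<in>UNIV. \<Sum>\<nu>\<in>UNIV. pa $ \<alpha> $ \<beta> / 4 * (pa $ \<mu> $ \<nu> * (u $ \<mu> * u $ \<nu>))
        + pb $ \<alpha> $ \<beta> / 4 * (pb $ \<mu> $ \<nu> * (u $ \<mu> * u $ \<nu>)))"
      unfolding app4_def P sq_tensor_def by (intro sum.cong refl) (simp add: field_simps)
    then show ?thesis
      unfolding sum2_linear a_def b_def quadratic_form_sum by (simp add: field_simps)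
  qed
  have appQ: "app4 Q (sq_tensor u) \<alpha> \<beta> = - (a * pb $ \<alpha> $ \<beta> + b * pa $ \<alpha> $ \<beta>) / 4" for \<alpha> \<beta>
  proof -
    have "app4 Q (sq_tensor u) \<alpha> \<beta> = (\<Sum>\<mu>\<in>UNIV. \<Sum>\<nu>\<in>UNIV. - pb $ \<alpha> $ \<beta> / 4 * (pa $ \<mu> $ \<nu> * (u $ \<mu> * u $ \<nu>))
        + - pa $ \<alpha> $ \<beta> / 4 * (pb $ \<mu> $ \<nu> * (u $ \<mu> * u $ \<nu>)))"
      unfolding app4_def Q sq_tensor_def by (intro sum.cong refl) (simp add: field_simps)
    then show ?thesis
      unfolding sum2_linear a_def b_def quadratic_form_sum by (simp add: field_simps)
  qed
  have quad: "quad4 S (sq_tensor u) = (\<Sum>\<alpha>\<in>UNIV. \<Sum>\<beta>\<in>UNIV. app4 S (sq_tensor u) \<alpha> \<beta> * (u $ \<alpha> * u $ \<beta>))" for S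
    by (simp add: quad4_def app4_def sq_tensor_def sum_distrib_left sum_distrib_right mult_ac)
  have lin: "(\<Sum>\<alpha>\<in>UNIV. \<Sum>\<beta>\<in>UNIV. (x * pa $ \<alpha> $ \<beta> + y * pb $ \<alpha> $ \<beta>) / 4 * (u $ \<alpha> * u $ \<beta>)) = (x * a + y * b) / 4" for x y
  proof -
    have "(\<Sum>\<alpha>\<in>UNIV. \<Sum>\<beta>\<in>UNIV. (x * pa $ \<alpha> $ \<beta> + y * pb $ \<alpha> $ \<beta>) / 4 * (u $ \<alpha> * u $ \<beta>))
      = (\<Sum>\<alpha>\<in>UNIV. \<Sum>\<beta>\<in>UNIV. x / 4 * (pa $ \<alpha> $ \<beta> * (u $ \<alpha> * u $ \<beta>)) + y / 4 * (pb $ \<alpha> $ \<beta> * (u $ \<alpha> * u $ \<beta>)))"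
      by (intro sum.cong refl) (simp add: field_simps)
    then show ?thesis
      unfolding sum2_linear a_def b_def quadratic_form_sum by (simp add: field_simps)
  qed
  have "quad4 P (sq_tensor u) = (a * a + b * b) / 4"
    unfolding quad appP lin ..
  moreover have "quad4 Q (sq_tensor u) = - (a * b) / 2"
    using lin[of "- b" "- a"] unfolding quad appQ by (simp add: algebra_simps)
  ultimately have "W0_radicand P Q (sq_tensor u) = ((a * a + b * b) / 4)\<^sup>2 - (- (a * b) / 2)\<^sup>2"
    by (simp only: W0_radicand_def)
  then show rad: "W0_radicand P Q (sq_tensor u) = (a\<^sup>2 - b\<^sup>2)\<^sup>2 / 16"
    by (simp add: power2_eq_square field_simps)
  have "sqrt (W0_radicand P Q (sq_tensor u)) = \<bar>a\<^sup>2 - b\<^sup>2\<bar> / 4"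
    unfolding rad by (simp add: real_sqrt_divide)
  moreover have "wedge (app4 P (sq_tensor u)) (app4 P (sq_tensor u)) \<alpha> \<beta> \<mu> \<nu> - wedge (app4 Q (sq_tensor u)) (app4 Q (sq_tensor u)) \<alpha> \<beta> \<mu> \<nu>
      = (a\<^sup>2 - b\<^sup>2) / 8 * (minor2 pa \<alpha> \<beta> \<mu> \<nu> - minor2 pb \<alpha> \<beta> \<mu> \<nu>)"
    unfolding wedge_def appP appQ minor2_def power2_eq_square
    by (simp add: field_simps)
  ultimately have eq: "W0_tensor t P Q (sq_tensor u) \<alpha> \<beta> \<mu> \<nu>
      = sqrt t * ((a\<^sup>2 - b\<^sup>2) / 8 * (minor2 pa \<alpha> \<beta> \<mu> \<nu> - minor2 pb \<alpha> \<beta> \<mu> \<nu>) / (\<bar>a\<^sup>2 - b\<^sup>2\<bar> / 4))"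
    by (simp only: W0_tensor_def)
  \<comment> \<open>For \<open>d = 0\<close> both sides vanish, since division by zero yields 0 and
    \<open>sgn 0 = 0\<close>.\<close>
  have sg: "d / 8 * D / (\<bar>d\<bar> / 4) = sgn d / 2 * D" for d D :: real
    by (simp add: sgn_if abs_if)
  show "W0_tensor t P Q (sq_tensor u) \<alpha> \<beta> \<mu> \<nu>
      = sqrt t / 2 * sgn (a\<^sup>2 - b\<^sup>2) * (minor2 pa \<alpha> \<beta> \<mu> \<nu> - minor2 pb \<alpha> \<beta> \<mu> \<nu>)"
    unfolding eq sg by simp
qed

end

section \<open>The symmetric tensors of an orthonormal pair\<close>

definition hermr :: "complex^3 \<Rightarrow> real^4^4" where
  "hermr z = map_matrix Re (herm z z)"

lemma cmat_hermr: "cmat (hermr z) = herm z z"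
proof -
  have "\<forall>a b. cnj (herm z z $ a $ b) = herm z z $ a $ b"
    unfolding herm_explicit forall_4 by (simp add: algebra_simps)
  then show ?thesis
    by (simp add: hermr_def vec_eq_iff) (metis Reals_cnj_iff of_real_Re)
qed

lemma eta_eta: "eta ** eta = mat 1"
  by (simp add: vec_eq_iff forall_4 matrix_matrix_mult_def sum_4 eta_nth mat_def)

lemma transpose_eta: "transpose eta = eta"
  by (simp add: eta_def transpose_minkowski flip: cmat_transpose)

lemma matrix_neg_mult: "(- A) ** B = - (A ** B)" "A ** (- B) = - (A ** B)" for A :: "'a::ring_1^'n^'m"
  by (simp_all add: vec_eq_iff matrix_matrix_mult_def sum_negf)

lemma cnjm_neg: "cnjm (- A) = - cnjm A"
  by (simp add: vec_eq_iff)

lemma herm_alt: "herm z w = - (sd z ** eta ** cnjm (sd w))"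
  by (simp add: herm_def sd_antisym cnjm_neg matrix_neg_mult flip: cnjm_transpose)

text \<open>The inner two factors commute, which collects the conjugates on the right: the product
  is \<open>K ** eta ** cnjm K\<close>, where \<open>K\<close> is the product of the
  bivectors.\<close>

lemma herm_mult:
  "herm z z ** eta ** herm w w = sd z ** eta ** sd w ** eta ** cnjm (sd z ** eta ** sd w)"
proof -
  have "herm z z ** eta ** herm w w = sd z ** eta ** (cnjm (sd z) ** eta ** sd w) ** eta ** cnjm (sd w)"
    by (simp add: herm_alt matrix_neg_mult matrix_mul_assoc)
  also have "\<dots> = sd z ** eta ** (sd w ** eta ** cnjm (sd z)) ** eta ** cnjm (sd w)"
    by (simp only: sd_commute)
  finally show ?thesis
    by (simp add: cnjm_mult matrix_mul_assoc) (simp add: eta_def cnjm_cmat)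
qed

lemma hermr_symmetric: "transpose (hermr z) = hermr z"
  by (simp add: herm_sym cmat_hermr cmat_transpose flip: cmat_inject)

lemma hermr_square:
  assumes "cdot z z = 1"
  shows "hermr z ** minkowski ** hermr z = minkowski"
proof -
  have ce: "cnjm eta = eta" by (simp add: eta_def cnjm_cmat)
  have "herm z z ** eta ** herm z z = eta"
    unfolding herm_mult sd_square[OF assms] ce by (simp add: eta_eta)
  then show ?thesis
    by (simp add: cmat_mult cmat_hermr flip: cmat_inject eta_def)
qed

context
  fixes a b :: "complex^3"
  assumes a: "cdot a a = 1" and b: "cdot b b = 1" and ab: "cdot a b = 0"
begin

text \<open>Exchanging \<open>a\<close> and \<open>b\<close> changes the sign of the product of
  bivectors and of its conjugate, and the two signs cancel.\<close>

lemma hermr_commute: "hermr b ** minkowski ** hermr a = hermr a ** minkowski ** hermr b"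
proof -
  have "herm b b ** eta ** herm a a = herm a a ** eta ** herm b b"
    unfolding herm_mult sd_anticommute[OF ab]
    by (simp add: matrix_neg_mult cnjm_neg)
  then show ?thesis
    by (simp add: cmat_mult cmat_hermr flip: cmat_inject eta_def)
qed

lemma hermr_orthogonal: "trace (minkowski ** hermr a ** minkowski ** hermr b) = 0"
proof -
  have "complex_of_real (trace (minkowski ** hermr a ** minkowski ** hermr b)) = 0"
    using herm_gram[of a a b b]
    by (simp add: cmat_mult cmat_hermr ab flip: cmat_trace eta_def)
  then show ?thesis by simp
qed

lemma hermr_timelike_pos:
  assumes y: "y \<bullet> (minkowski *v y) < 0"
  shows "y \<bullet> (hermr a *v y) > 0" "y \<bullet> (hermr b *v y) > 0"
proof -
  have "y \<bullet> (hermr z *v y) > 0" if "cdot z z = 1" for z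
  proof (rule antisym_herm_pos[of "sd z" 1])
    show "sd z ** eta ** sd z ** eta = mat 1"
      by (simp add: sd_square[OF that] eta_eta)
  qed (simp_all add: sd_antisym cmat_hermr herm_def y)
  then show "y \<bullet> (hermr a *v y) > 0" "y \<bullet> (hermr b *v y) > 0" using a b by auto
qed

text \<open>Orthogonality of \<open>a\<close> and \<open>b\<close> makes \<open>K\<close>
  antisymmetric, so \<open>antisym_herm_pos\<close> applies to it; the conjugate enters without
  transposition here, which reverses the sign.\<close>

lemma hermr_mult_timelike_neg:
  assumes y: "y \<bullet> (minkowski *v y) < 0"
  shows "y \<bullet> (hermr a ** minkowski ** hermr b *v y) < 0"
proof -
  define K where "K = sd a ** eta ** sd b"
  have "transpose K = sd b ** eta ** sd a"
    by (simp add: K_def matrix_transpose_mul sd_antisym transpose_eta matrix_neg_mult matrix_mul_assoc)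
  then have anti: "transpose K = - K"
    by (simp add: K_def sd_anticommute[OF ab])
  have "K ** eta ** K ** eta = sd a ** eta ** (sd b ** eta ** sd a) ** eta ** sd b ** eta"
    by (simp add: K_def matrix_mul_assoc)
  also have "sd b ** eta ** sd a = - (sd a ** eta ** sd b)"
    by (simp add: sd_anticommute[OF ab])
  also have "sd a ** eta ** - (sd a ** eta ** sd b) ** eta ** sd b ** eta
      = - ((sd a ** eta ** sd a) ** eta ** (sd b ** eta ** sd b) ** eta)"
    by (simp add: matrix_neg_mult matrix_mul_assoc)
  also have "\<dots> = mat (- 1)"
    by (simp add: sd_square a b eta_eta) (simp add: vec_eq_iff mat_def)
  finally have inv: "K ** eta ** K ** eta = mat (- 1)" .
  have "y \<bullet> ((- (hermr a ** minkowski ** hermr b)) *v y) > 0"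
  proof (rule antisym_herm_pos[OF anti inv _ _ y])
    have "cmat (hermr a ** minkowski ** hermr b) = herm a a ** eta ** herm b b"
      by (simp add: cmat_mult cmat_hermr eta_def)
    also have "\<dots> = K ** eta ** cnjm K"
      unfolding herm_mult K_def by (simp add: matrix_mul_assoc)
    also have "\<dots> = - (K ** eta ** transpose (cnjm K))"
      by (simp add: anti cnjm_neg matrix_neg_mult flip: cnjm_transpose)
    finally show "cmat (- (hermr a ** minkowski ** hermr b)) = K ** eta ** transpose (cnjm K)"
      by (simp add: vec_eq_iff)
  qed simp
  moreover have "(- X) *v y = - (X *v y)" for X :: "real^4^4"
    by (simp add: vec_eq_iff matrix_vector_mult_def sum_negf)
  ultimately show ?thesis by simp
qed

end

text \<open>Time-like vectors form a nonempty open set, on which a nonzero quadratic form cannot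
  vanish. This serves to find a \<open>u\<close> with nonzero radicand.\<close>

lemma symmetric_zero_on_timelike:
  fixes D :: "real^4^4"
  assumes sym: "transpose D = D"
    and zero: "\<And>y. y \<bullet> (minkowski *v y) < 0 \<Longrightarrow> y \<bullet> (D *v y) = 0"
  shows "D = 0"
proof -
  have s: "D $ i $ j = D $ j $ i" for i j
    using sym by (auto simp: vec_eq_iff transpose_def)
  note S = s[of 2 1] s[of 3 1] s[of 4 1] s[of 3 2] s[of 4 2] s[of 4 3]
  \<comment> \<open>Time component 2 admits the ten test vectors used below, with space components
    0, 1, -1 and at most two of them nonzero; they determine all ten coefficients.\<close>
  have q: "4 * D$1$1 + x*x * D$2$2 + y*y * D$3$3 + z*z * D$4$4 + 4*x * D$1$2 + 4*y * D$1$3 + 4*z * D$1$4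
     + 2*x*y * D$2$3 + 2*x*z * D$2$4 + 2*y*z * D$3$4 = 0" if "x*x + y*y + z*z < 4" for x y z
  proof -
    have "vector [2,x,y,z] \<bullet> (D *v vector [2,x,y,z]) = 0"
      using that by (intro zero) (simp add: inner_vec_def matrix_vector_mult_def sum_4 minkowski_def)
    then show ?thesis
      by (simp add: inner_vec_def matrix_vector_mult_def sum_4 S algebra_simps)
  qed
  have "\<forall>i j. D $ i $ j = 0"
    unfolding forall_4 S
    using q[of 0 0 0] q[of 1 0 0] q[of "-1" 0 0] q[of 0 1 0] q[of 0 "-1" 0] q[of 0 0 1] q[of 0 0 "-1"]
      q[of 1 1 0] q[of 1 0 1] q[of 0 1 1] by simp
  then show ?thesis by (simp add: vec_eq_iff)
qed

section \<open>Minors and outer products under a change of basis\<close>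

lemma congruence_expand:
  "(transpose B ** X ** B) $ a $ m = (\<Sum>i\<in>UNIV. \<Sum>j\<in>UNIV. B $ i $ a * B $ j $ m * X $ i $ j)"
  for B :: "'a::comm_semiring_1^'n^'n"
  by (simp add: matrix_mult3_nth' transpose_def mult_ac)

lemma minor2_congruence:
  "minor2 (transpose B ** X ** B) a b m n = (\<Sum>i\<in>UNIV. \<Sum>j\<in>UNIV. \<Sum>k\<in>UNIV. \<Sum>l\<in>UNIV.
     B $ i $ a * B $ j $ b * B $ k $ m * B $ l $ n * minor2 X i j k l)"
  for B :: "'a::comm_ring_1^4^4"
  unfolding minor2_def congruence_expand sum_factor_13_24[symmetric]
  by (subst sum_factor_13_24, subst sum_factor_14_23[symmetric])
     (simp add: algebra_simps sum_subtractf)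

lemma outer_congruence:
  "(transpose B ** X ** B) $ a $ b * (transpose B ** Y ** B) $ m $ n = (\<Sum>i\<in>UNIV. \<Sum>j\<in>UNIV. \<Sum>k\<in>UNIV. \<Sum>l\<in>UNIV.
     B $ i $ a * B $ j $ b * B $ k $ m * B $ l $ n * (X $ i $ j * Y $ k $ l))"
  for B :: "'a::comm_ring_1^4^4"
  unfolding congruence_expand sum_factor_12_34[symmetric] by (simp add: mult_ac)

definition sd_frame :: "real^4^4 \<Rightarrow> complex^3 \<Rightarrow> complex^4^4" where
  "sd_frame B z = transpose (cmat B) ** sd z ** cmat B"

text \<open>The metric terms of \<open>herm_minors\<close> agree for the two unit vectors and
  cancel, leaving a complex number plus its conjugate.\<close>

lemma minor2_hermr:
  assumes "cdot a a = 1" "cdot b b = 1"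
  shows "minor2 (transpose B ** hermr a ** B) \<alpha> \<beta> \<mu> \<nu> - minor2 (transpose B ** hermr b ** B) \<alpha> \<beta> \<mu> \<nu>
    = - 2 * Re (sd_frame B a $ \<alpha> $ \<beta> * sd_frame B a $ \<mu> $ \<nu> - sd_frame B b $ \<alpha> $ \<beta> * sd_frame B b $ \<mu> $ \<nu>)"
proof -
  let ?B = "cmat B"
  have 1: "complex_of_real (minor2 (transpose B ** hermr z ** B) \<alpha> \<beta> \<mu> \<nu>)
      = - minor2 (transpose ?B ** eta ** ?B) \<alpha> \<beta> \<mu> \<nu>
        - (sd_frame B z $ \<alpha> $ \<beta> * sd_frame B z $ \<mu> $ \<nu>) - cnj (sd_frame B z $ \<alpha> $ \<beta> * sd_frame B z $ \<mu> $ \<nu>)"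
    if "cdot z z = 1" for z
  proof -
    have "complex_of_real (minor2 (transpose B ** hermr z ** B) \<alpha> \<beta> \<mu> \<nu>)
        = minor2 (cmat (transpose B ** hermr z ** B)) \<alpha> \<beta> \<mu> \<nu>"
      by (simp add: minor2_def)
    also have "\<dots> = minor2 (transpose ?B ** herm z z ** ?B) \<alpha> \<beta> \<mu> \<nu>"
      by (simp add: cmat_mult cmat_transpose cmat_hermr)
    also have "\<dots> = - minor2 (transpose ?B ** eta ** ?B) \<alpha> \<beta> \<mu> \<nu>
        - (transpose ?B ** sd z ** ?B) $ \<alpha> $ \<beta> * (transpose ?B ** sd z ** ?B) $ \<mu> $ \<nu>
        - (transpose ?B ** cnjm (sd z) ** ?B) $ \<alpha> $ \<beta> * (transpose ?B ** cnjm (sd z) ** ?B) $ \<mu> $ \<nu>"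
    proof -
      have m: "minor2 (herm z z) i j k l = - minor2 eta i j k l - sd z $ i $ j * sd z $ k $ l
          - cnjm (sd z) $ i $ j * cnjm (sd z) $ k $ l" for i j k l
        using herm_minors[of z i k j l] that by (simp add: minor2_def)
      show ?thesis
        unfolding minor2_congruence outer_congruence m
        by (simp only: right_diff_distrib sum_subtractf mult_minus_right sum_negf)
    qed
    also have "transpose ?B ** cnjm (sd z) ** ?B = cnjm (sd_frame B z)"
      by (simp add: sd_frame_def cnjm_mult cnjm_transpose cnjm_cmat)
    finally show ?thesis by (simp add: sd_frame_def)
  qed
  have "complex_of_real (minor2 (transpose B ** hermr a ** B) \<alpha> \<beta> \<mu> \<nu> - minor2 (transpose B ** hermr b ** B) \<alpha> \<beta> \<mu> \<nu>)
    = complex_of_real (- 2 * Re (sd_frame B a $ \<alpha> $ \<beta> * sd_frame B a $ \<mu> $ \<nu> - sd_frame B b $ \<alpha> $ \<beta> * sd_frame B b $ \<mu> $ \<nu>))"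
    unfolding of_real_diff 1[OF assms(1)] 1[OF assms(2)]
    by (simp add: complex_eq_iff)
  then show ?thesis by (simp only: of_real_eq_iff)
qed

lemma sdcol_frame_sum:
  "(\<Sum>i\<in>UNIV. (transpose (kron (cmat B) (cmat B)) ** sdcol) $ (\<alpha>, \<beta>) $ i * z $ i) = sd_frame B z $ \<alpha> $ \<beta>"
proof -
  have col: "sd z $ a $ b = (\<Sum>i\<in>UNIV. sd (axis i 1) $ a $ b * z $ i)" for a b
  proof -
    have "\<forall>a b. sd z $ a $ b = (\<Sum>i\<in>UNIV. sd (axis i 1) $ a $ b * z $ i)"
      unfolding forall_4 sum_3 by (simp add: sd_def axis_def)
    then show ?thesis by blast
  qed
  \<comment> \<open>The vector becomes a one-column matrix so that associativity of matrix
    multiplication applies.\<close>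
  define Z :: "complex^1^3" where "Z = (\<chi> i _. z $ i)"
  have "(\<Sum>i\<in>UNIV. (transpose (kron (cmat B) (cmat B)) ** sdcol) $ (\<alpha>, \<beta>) $ i * z $ i)
      = (transpose (kron (cmat B) (cmat B)) ** (sdcol ** Z)) $ (\<alpha>, \<beta>) $ 1"
    unfolding matrix_mul_assoc matrix_matrix_mult_def[of "transpose (kron (cmat B) (cmat B)) ** sdcol" Z]
    by (simp add: Z_def)
  also have "\<dots> = sd_frame B z $ \<alpha> $ \<beta>"
    unfolding kron_transpose_mult_nth sd_frame_def
    by (simp add: matrix_matrix_mult_def[of sdcol] Z_def vec_lambda_eta flip: col)
  finally show ?thesis .
qed

lemma hermcol_frame_sum:
  "(\<Sum>i\<in>UNIV. \<Sum>k\<in>UNIV. (transpose (kron (cmat B) (cmat B)) ** hermcol) $ (\<alpha>, \<beta>) $ (i, k) * (z $ i * cnj (z $ k)))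
    = complex_of_real ((transpose B ** hermr z ** B) $ \<alpha> $ \<beta>)"
proof -
  define Z :: "complex^1^(3\<times>3)" where "Z = (\<chi> p _. z $ fst p * cnj (z $ snd p))"
  have "(\<Sum>i\<in>UNIV. \<Sum>k\<in>UNIV. (transpose (kron (cmat B) (cmat B)) ** hermcol) $ (\<alpha>, \<beta>) $ (i, k) * (z $ i * cnj (z $ k)))
      = (transpose (kron (cmat B) (cmat B)) ** (hermcol ** Z)) $ (\<alpha>, \<beta>) $ 1"
    unfolding matrix_mul_assoc matrix_matrix_mult_def[of "transpose (kron (cmat B) (cmat B)) ** hermcol" Z]
    by (simp add: Z_def sum_prod_UNIV)
  also have "\<dots> = (transpose (cmat B) ** herm z z ** cmat B) $ \<alpha> $ \<beta>"
    unfolding kron_transpose_mult_nth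
    by (simp add: matrix_matrix_mult_def[of hermcol] Z_def sum_prod_UNIV vec_lambda_eta flip: herm_sum)
  also have "\<dots> = cmat (transpose B ** hermr z ** B) $ \<alpha> $ \<beta>"
    by (simp only: cmat_mult cmat_transpose cmat_hermr)
  finally show ?thesis by simp
qed

section \<open>Recovering the Weyl tensor\<close>

lemma mat_mult_nth: "(mat c ** A) $ i $ j = c * A $ i $ j" for A :: "'a::semiring_1^'n^'m"
  by (simp add: matrix_matrix_mult_def mat_def if_distrib if_distribR cong: if_cong)

lemma mult_mat_commute: "A ** mat c = mat c ** A" for A :: "'a::comm_semiring_1^'n^'m"
  by (simp add: vec_eq_iff mat_mult_nth)
    (simp add: matrix_matrix_mult_def mat_def if_distrib if_distribR mult.commute cong: if_cong)

lemma trace_mat_mult: "trace (mat c ** A) = c * trace A" for A :: "'a::comm_semiring_1^'n^'n"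
  by (simp add: trace_def mat_mult_nth sum_distrib_left)

text \<open>The columns of \<open>N\<close> have a scalar Gram matrix, so composing tensors means
  multiplying their coefficient matrices, with one factor \<open>c\<close> for each
  composition.\<close>

lemma comp4_factored:
  assumes gram: "transpose N ** cmat (kron (matrix_inv g) (matrix_inv g)) ** N = mat c"
    and R: "cmat (mat4 R) = N ** X ** transpose N" and S: "cmat (mat4 S) = N ** Y ** transpose N"
  shows "cmat (mat4 (comp4 g R S)) = N ** (mat c ** (X ** Y)) ** transpose N"
proof -
  have "cmat (mat4 (comp4 g R S))
      = N ** X ** (transpose N ** cmat (kron (matrix_inv g) (matrix_inv g)) ** N) ** Y ** transpose N"
    by (simp add: mat4_comp4 cmat_mult R S matrix_mul_assoc)
  then show ?thesis
    unfolding gram by (simp add: matrix_mul_assoc mult_mat_commute[of "N ** X"]) (simp add: mult_mat_commute matrix_mul_assoc)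
qed

lemma tr4_factored:
  assumes gram: "transpose N ** cmat (kron (matrix_inv g) (matrix_inv g)) ** N = mat c"
    and R: "cmat (mat4 R) = N ** X ** transpose N"
  shows "complex_of_real (tr4 g R) = c * trace X"
proof -
  have "complex_of_real (tr4 g R) = trace ((cmat (kron (matrix_inv g) (matrix_inv g)) ** N ** X) ** transpose N)"
    by (simp add: tr4_mat4 cmat_mult R matrix_mul_assoc flip: cmat_trace)
  also have "\<dots> = trace ((transpose N ** cmat (kron (matrix_inv g) (matrix_inv g)) ** N) ** X)"
    by (subst trace_mul_sym) (simp add: matrix_mul_assoc)
  finally show ?thesis
    unfolding gram trace_mat_mult .
qed

lemma hermcol_gram_frame:
  assumes AB: "B ** A = mat 1" and inv: "matrix_inv g = A ** minkowski ** transpose A"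
  defines "N \<equiv> transpose (kron (cmat B) (cmat B)) ** hermcol"
  shows "transpose N ** cmat (kron (matrix_inv g) (matrix_inv g)) ** N = mat 4"
proof -
  let ?A = "kron (cmat A) (cmat A)" and ?B = "kron (cmat B) (cmat B)"
  have BA: "?B ** ?A = mat 1"
    by (simp add: kron_mult kron_one AB cmat_one flip: cmat_mult)
  then have BA': "transpose ?A ** transpose ?B = mat 1"
    by (metis matrix_transpose_mul transpose_mat)
  have "cmat (kron (matrix_inv g) (matrix_inv g)) = ?A ** kron eta eta ** transpose ?A"
    by (simp add: inv kron_mult kron_transpose kron_cmat cmat_mult cmat_transpose eta_def)
  then have "transpose N ** cmat (kron (matrix_inv g) (matrix_inv g)) ** N
      = transpose hermcol ** (?B ** ?A) ** kron eta eta ** (transpose ?A ** transpose ?B) ** hermcol"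
    by (simp add: N_def matrix_transpose_mul matrix_mul_assoc)
  then show ?thesis by (simp add: BA BA' hermcol_gram)
qed

text \<open>Duality acts on the first pair of indices, where self-dual bivectors have the eigenvalue
  \<i>; \<open>x\<close> and \<open>y\<close> carry the second pair. Being a real operator, it
  commutes with taking real parts.\<close>

lemma hodge_of_real_part:
  assumes AB: "A ** B = mat 1" "B ** A = mat 1" and vol: "s * sqrt \<bar>det g\<bar> = det B"
    and inv: "matrix_inv g = A ** minkowski ** transpose A"
    and S: "\<And>\<alpha> \<beta> \<mu> \<nu>. S \<alpha> \<beta> \<mu> \<nu> = Re (sd_frame B z $ \<alpha> $ \<beta> * x \<mu> \<nu> + sd_frame B w $ \<alpha> $ \<beta> * y \<mu> \<nu>)"
  shows "hodge g s S \<alpha> \<beta> \<mu> \<nu> = Re (\<i> * (sd_frame B z $ \<alpha> $ \<beta> * x \<mu> \<nu> + sd_frame B w $ \<alpha> $ \<beta> * y \<mu> \<nu>))"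
proof -
  define C where "C = transpose (kron (cmat B) (cmat B)) ** sdcol"
  define E where "E = mat4 (volume_element g s) ** kron (matrix_inv g) (matrix_inv g)"
  have EC: "cmat E ** C = mat (2 * \<i>) ** C"
    unfolding E_def C_def cmat_mult by (rule hodge_sdcol[OF AB vol inv])
  have E: "(\<Sum>\<rho>\<in>UNIV. \<Sum>\<sigma>\<in>UNIV. of_real (E $ (\<alpha>, \<beta>) $ (\<rho>, \<sigma>)) * sd_frame B v $ \<rho> $ \<sigma>)
      = 2 * \<i> * sd_frame B v $ \<alpha> $ \<beta>" for v
  proof -
    have "(\<Sum>\<rho>\<in>UNIV. \<Sum>\<sigma>\<in>UNIV. of_real (E $ (\<alpha>, \<beta>) $ (\<rho>, \<sigma>)) * sd_frame B v $ \<rho> $ \<sigma>)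
        = (\<Sum>p\<in>UNIV. \<Sum>i\<in>UNIV. of_real (E $ (\<alpha>, \<beta>) $ p) * C $ p $ i * v $ i)"
      by (simp add: sum_prod_UNIV C_def mult.assoc flip: sdcol_frame_sum sum_distrib_left)
    also have "\<dots> = (\<Sum>i\<in>UNIV. \<Sum>p\<in>UNIV. of_real (E $ (\<alpha>, \<beta>) $ p) * C $ p $ i * v $ i)"
      by (rule sum.swap)
    also have "\<dots> = (\<Sum>i\<in>UNIV. (cmat E ** C) $ (\<alpha>, \<beta>) $ i * v $ i)"
      by (simp add: matrix_matrix_mult_def[of "cmat E"] sum_distrib_right)
    also have "\<dots> = 2 * \<i> * sd_frame B v $ \<alpha> $ \<beta>"
      unfolding EC mat_mult_nth by (simp add: C_def sum_distrib_left mult.assoc flip: sdcol_frame_sum)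
    finally show ?thesis .
  qed
  have "hodge g s S \<alpha> \<beta> \<mu> \<nu> = (1/2) * (\<Sum>\<rho>\<in>UNIV. \<Sum>\<sigma>\<in>UNIV. E $ (\<alpha>, \<beta>) $ (\<rho>, \<sigma>) * S \<rho> \<sigma> \<mu> \<nu>)"
  proof -
    have "hodge g s S \<alpha> \<beta> \<mu> \<nu> = mat4 (hodge g s S) $ (\<alpha>, \<beta>) $ (\<mu>, \<nu>)" by simp
    then show ?thesis
      unfolding mat4_hodge by (simp add: E_def matrix_matrix_mult_def[of _ "mat4 S"] sum_prod_UNIV)
  qed
  also have "\<dots> = Re ((1/2) * (\<Sum>\<rho>\<in>UNIV. \<Sum>\<sigma>\<in>UNIV. x \<mu> \<nu> * (of_real (E $ (\<alpha>, \<beta>) $ (\<rho>, \<sigma>)) * sd_frame B z $ \<rho> $ \<sigma>)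
      + y \<mu> \<nu> * (of_real (E $ (\<alpha>, \<beta>) $ (\<rho>, \<sigma>)) * sd_frame B w $ \<rho> $ \<sigma>)))"
    unfolding S by (simp add: algebra_simps)
  also have "\<dots> = Re (\<i> * (sd_frame B z $ \<alpha> $ \<beta> * x \<mu> \<nu> + sd_frame B w $ \<alpha> $ \<beta> * y \<mu> \<nu>))"
    unfolding sum2_linear E by (simp add: algebra_simps)
  finally show ?thesis .
qed

text \<open>With \<open>E = a a^T\<close> and \<open>F = b b^T\<close>, \<open>M\<close> is
  \<open>l (E - F)\<close> and its square is \<open>l^2 (E + F)\<close>. As
  \<open>|l|^2 = t / 4\<close>, the two summands of \<open>P\<close> receive the same weight 1/8,
  and the mixed Kronecker products of \<open>E\<close> and \<open>F\<close> cancel.\<close>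

lemma P_tensor_decomposition:
  fixes B :: "real^4^4"
  defines "N \<equiv> transpose (kron (cmat B) (cmat B)) ** hermcol"
  assumes T: "cmat (mat4 T) = N ** kron M (cnjm M) ** transpose N"
    and T2: "cmat (mat4 (comp4 g T T)) = N ** (mat 4 ** (kron M (cnjm M) ** kron M (cnjm M))) ** transpose N"
    and M: "\<And>i j. M $ i $ j = l * (a $ i * a $ j - b $ i * b $ j)"
    and ab: "cdot a a = 1" "cdot b b = 1" "cdot a b = 0"
    and t: "t = 4 * (norm l)\<^sup>2" "t > 0"
  shows "P_tensor g t T \<alpha> \<beta> \<mu> \<nu>
    = ((transpose B ** hermr a ** B) $ \<alpha> $ \<beta> * (transpose B ** hermr a ** B) $ \<mu> $ \<nu>
     + (transpose B ** hermr b ** B) $ \<alpha> $ \<beta> * (transpose B ** hermr b ** B) $ \<mu> $ \<nu>) / 4"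
proof -
  have ll: "l * cnj l = of_real (t / 4)"
    using t by (simp add: complex_norm_square[symmetric])
  have M2: "(M ** M) $ i $ j = l\<^sup>2 * (a $ i * a $ j + b $ i * b $ j)" for i j
  proof -
    have "(M ** M) $ i $ j = l\<^sup>2 * (a $ i * a $ j * cdot a a - (a $ i * b $ j + b $ i * a $ j) * cdot a b + b $ i * b $ j * cdot b b)"
      by (simp add: matrix_matrix_mult_def M cdot_def sum_3 power2_eq_square algebra_simps)
    then show ?thesis by (simp add: ab algebra_simps)
  qed
  \<comment> \<open>\<open>e z\<close> is the product of \<open>z\<close> with its conjugate, whose
    image under \<open>N\<close> is the symmetric tensor of \<open>z\<close>.\<close>
  define e where "e z p = z $ fst p * cnj (z $ snd p)" for z :: "complex^3" and p :: "3 \<times> 3"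
  have K: "1 / (2 * of_real t) * kron M (cnjm M) $ r $ q
      + 1 / (2 * of_real t ^ 2) * (mat 4 ** (kron M (cnjm M) ** kron M (cnjm M))) $ r $ q
    = (e a r * e a q + e b r * e b q) / 4" for r q
  proof -
    obtain i k j n where rq: "r = (i, k)" "q = (j, n)" by (metis surj_pair)
    have 1: "kron M (cnjm M) $ r $ q = (l * cnj l) * ((a $ i * a $ j - b $ i * b $ j) * cnj (a $ k * a $ n - b $ k * b $ n))"
      by (simp add: rq M algebra_simps)
    have 2: "(mat 4 ** (kron M (cnjm M) ** kron M (cnjm M))) $ r $ q
      = 4 * (l * cnj l)\<^sup>2 * ((a $ i * a $ j + b $ i * b $ j) * cnj (a $ k * a $ n + b $ k * b $ n))"
      unfolding mat_mult_nth kron_mult cnjm_mult[symmetric]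
      by (simp add: rq M2 power_mult_distrib algebra_simps)
    have tn: "complex_of_real t \<noteq> 0" using t by simp
    show ?thesis
      unfolding 1 2 unfolding ll e_def rq using tn
      by (simp add: power2_eq_square field_simps)
  qed
  have Ne: "(\<Sum>r\<in>UNIV. N $ (\<alpha>, \<beta>) $ r * e z r) = of_real ((transpose B ** hermr z ** B) $ \<alpha> $ \<beta>)" for z \<alpha> \<beta>
    using hermcol_frame_sum[of B \<alpha> \<beta> z] by (simp add: N_def e_def sum_prod_UNIV)
  have "complex_of_real (P_tensor g t T \<alpha> \<beta> \<mu> \<nu>)
      = 1 / (2 * of_real t) * cmat (mat4 T) $ (\<alpha>, \<beta>) $ (\<mu>, \<nu>)
        + 1 / (2 * of_real t ^ 2) * cmat (mat4 (comp4 g T T)) $ (\<alpha>, \<beta>) $ (\<mu>, \<nu>)"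
    by (simp add: P_tensor_def)
  also have "\<dots> = (\<Sum>q\<in>UNIV. \<Sum>r\<in>UNIV. N $ (\<alpha>, \<beta>) $ r * (1 / (2 * of_real t) * kron M (cnjm M) $ r $ q
      + 1 / (2 * of_real t ^ 2) * (mat 4 ** (kron M (cnjm M) ** kron M (cnjm M))) $ r $ q) * N $ (\<mu>, \<nu>) $ q)"
    unfolding T T2 congruence_nth sum2_linear[symmetric]
    by (intro sum.cong refl) (simp add: algebra_simps)
  also have "\<dots> = (\<Sum>q\<in>UNIV. \<Sum>r\<in>UNIV. (1/4) * ((N $ (\<mu>, \<nu>) $ q * e a q) * (N $ (\<alpha>, \<beta>) $ r * e a r))
      + (1/4) * ((N $ (\<mu>, \<nu>) $ q * e b q) * (N $ (\<alpha>, \<beta>) $ r * e b r)))"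
    unfolding K by (intro sum.cong refl) (simp add: algebra_simps)
  also have "\<dots> = (1/4) * ((\<Sum>q\<in>UNIV. N $ (\<mu>, \<nu>) $ q * e a q) * (\<Sum>r\<in>UNIV. N $ (\<alpha>, \<beta>) $ r * e a r))
      + (1/4) * ((\<Sum>q\<in>UNIV. N $ (\<mu>, \<nu>) $ q * e b q) * (\<Sum>r\<in>UNIV. N $ (\<alpha>, \<beta>) $ r * e b r))"
    unfolding sum2_linear sum_product ..
  also have "\<dots> = complex_of_real (((transpose B ** hermr a ** B) $ \<alpha> $ \<beta> * (transpose B ** hermr a ** B) $ \<mu> $ \<nu>
     + (transpose B ** hermr b ** B) $ \<alpha> $ \<beta> * (transpose B ** hermr b ** B) $ \<mu> $ \<nu>) / 4)"
    unfolding Ne by (simp add: field_simps)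
  finally show ?thesis by (simp only: of_real_eq_iff)
qed

text \<open>\<open>W0\<close> has a meaning only where its radicand is nonzero. The first conjunct
  secures the existence of such vectors, and the positivity claims make the square roots
  genuine.\<close>

theorem theorem4:
  fixes g :: "real^4^4" and s t :: real and W T P V :: "real tensor4"
    and X \<Pi>\<^sub>1 :: "real^4 \<Rightarrow> real tensor2" and Q :: "real^4 \<Rightarrow> real tensor4"
  assumes "lorentzian g" and "s = 1 \<or> s = - 1"
    and "weyl_tensor g W"
    and "T = bel_robinson g s W"
    and "tr4 g (comp4 g (comp4 g T T) T) = 0"
    and "4 * t\<^sup>2 = tr4 g (comp4 g T T)" and "tr4 g (comp4 g T T) \<noteq> 0" and "t > 0"
    and "P = P_tensor g t T"
    and "V = V_tensor g P"
    and "X = sq_tensor"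
    and "\<Pi>\<^sub>1 = (\<lambda>u. Pi1 V (X u))"
    and "Q = (\<lambda>u. Q_tensor g (\<Pi>\<^sub>1 u) P)"
  shows "(\<exists>u. timelike g u \<and> act_vec g (\<Pi>\<^sub>1 u) u \<noteq> u \<and> W0_radicand P (Q u) (X u) \<noteq> 0) \<and>
    (\<forall>u. timelike g u \<and> act_vec g (\<Pi>\<^sub>1 u) u \<noteq> u \<and> W0_radicand P (Q u) (X u) \<noteq> 0 \<longrightarrow>
       quad4 V (X u) > 0 \<and> W0_radicand P (Q u) (X u) > 0 \<and>
       (\<exists>\<theta>::real. \<forall>\<alpha> \<beta> \<mu> \<nu>.
          W \<alpha> \<beta> \<mu> \<nu> = cos \<theta> * W0_tensor t P (Q u) (X u) \<alpha> \<beta> \<mu> \<nu>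
                     + sin \<theta> * hodge g s (W0_tensor t P (Q u) (X u)) \<alpha> \<beta> \<mu> \<nu>))"
proof -
  obtain A B where AB: "A ** B = mat 1" "B ** A = mat 1" and g: "g = transpose B ** minkowski ** B"
    and inv: "matrix_inv g = A ** minkowski ** transpose A" and vol: "s * sqrt \<bar>det g\<bar> = det B"
    and gH: "g ** matrix_inv g = mat 1" "matrix_inv g ** g = mat 1"
    using oriented_frame[OF assms(1,2)] by metis
  define C where "C = transpose (kron (cmat B) (cmat B)) ** sdcol"
  define N where "N = transpose (kron (cmat B) (cmat B)) ** hermcol"
  obtain M where Msym: "transpose M = M" and trM: "trace M = 0"
    and CM: "mat4 (self_dual_weyl g s W) = C ** M ** transpose C"
    using self_dual_weyl_decomposition[OF AB vol inv assms(3)] unfolding C_def by metis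
  define S where "S = kron M (cnjm M)"
  have T: "cmat (mat4 T) = N ** S ** transpose N"
    unfolding assms(4) N_def S_def
    by (rule bel_robinson_decomposition[OF AB(2) inv CM[unfolded C_def]])
  have gram: "transpose N ** cmat (kron (matrix_inv g) (matrix_inv g)) ** N = mat 4"
    unfolding N_def by (rule hermcol_gram_frame[OF AB(2) inv])
  note T2 = comp4_factored[OF gram T T]
  note T3 = comp4_factored[OF gram T2 T]
  \<comment> \<open>Each composition contributes a factor 4, and so does the trace.\<close>
  have tr2: "complex_of_real (tr4 g (comp4 g T T)) = 16 * (trace (M ** M) * cnj (trace (M ** M)))"
    unfolding tr4_factored[OF gram T2] trace_mat_mult
    by (simp add: S_def kron_mult kron_trace flip: cnjm_mult trace_cnjm)
  have tr3: "complex_of_real (tr4 g (comp4 g (comp4 g T T) T)) = 64 * (trace (M ** M ** M) * cnj (trace (M ** M ** M)))"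
    unfolding tr4_factored[OF gram T3] trace_mat_mult
    by (simp add: S_def kron_mult kron_trace trace_mat_mult flip: cnjm_mult trace_cnjm matrix_mul_assoc)
  have "trace (M ** M ** M) = 0" using tr3 assms(5) by simp
  moreover have "trace (M ** M) \<noteq> 0" using tr2 assms(7) by auto
  ultimately obtain l a b where l: "2 * l\<^sup>2 = trace (M ** M)"
    and ab: "cdot a a = 1" "cdot b b = 1" "cdot a b = 0"
    and M: "\<And>i j. M $ i $ j = l * (a $ i * a $ j - b $ i * b $ j)"
    using symmetric_zero_det_spectral[OF Msym trM] by metis
  \<comment> \<open>This follows from \<open>4 t^2 = 16 |tr (M^2)|^2 = 64 |l|^4\<close>.\<close>
  have t: "t = 4 * (norm l)\<^sup>2"
  proof -
    have "complex_of_real (4 * t\<^sup>2) = 64 * (complex_of_real ((norm l)\<^sup>2))\<^sup>2"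
      unfolding assms(6) tr2 l[symmetric] complex_norm_square by (simp add: power2_eq_square mult_ac)
    also have "\<dots> = complex_of_real (64 * ((norm l)\<^sup>2)\<^sup>2)"
      by simp
    finally have "t\<^sup>2 = (4 * (norm l)\<^sup>2)\<^sup>2"
      unfolding of_real_eq_iff by (simp add: power2_eq_square)
    then show ?thesis by (rule power2_eq_imp_eq) (use assms(8) in auto)
  qed
  then have sqt: "sqrt t = 2 * norm l" by (simp add: real_sqrt_mult)
  have l0: "l \<noteq> 0" using t assms(8) by auto
  define pa where "pa = transpose B ** hermr a ** B"
  define pb where "pb = transpose B ** hermr b ** B"
  let ?H = "matrix_inv g"
  have P: "P \<alpha> \<beta> \<mu> \<nu> = (pa $ \<alpha> $ \<beta> * pa $ \<mu> $ \<nu> + pb $ \<alpha> $ \<beta> * pb $ \<mu> $ \<nu>) / 4" for \<alpha> \<beta> \<mu> \<nu>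
    unfolding assms(9) pa_def pb_def
    by (rule P_tensor_decomposition[OF T[unfolded N_def S_def] T2[unfolded N_def S_def] M ab t assms(8)])
  have BA': "transpose A ** transpose B = mat 1"
    using AB(2) by (metis matrix_transpose_mul transpose_mat)
  \<comment> \<open>Through this rule the relations between \<open>hermr a\<close> and
    \<open>hermr b\<close> carry over to \<open>pa\<close> and \<open>pb\<close>.\<close>
  have prod: "(transpose B ** x ** B) ** ?H ** (transpose B ** y ** B) = transpose B ** (x ** minkowski ** y) ** B" for x y
  proof -
    have "(transpose B ** x ** B) ** ?H ** (transpose B ** y ** B)
        = transpose B ** x ** (B ** A) ** minkowski ** (transpose A ** transpose B) ** y ** B"
      by (simp add: inv matrix_mul_assoc)
    then show ?thesis by (simp add: AB BA' matrix_mul_assoc)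
  qed
  have form: "u \<bullet> (transpose B ** x ** B *v u) = (B *v u) \<bullet> (x *v (B *v u))" for x u
    by (metis dot_lmul_matrix matrix_vector_mul_assoc transpose_matrix_vector inner_commute)
  have sym: "transpose pa = pa" "transpose pb = pb" "transpose ?H = ?H"
    by (simp_all add: pa_def pb_def inv matrix_transpose_mul hermr_symmetric transpose_minkowski matrix_mul_assoc)
  have sq: "pa ** ?H ** pa = g" "pb ** ?H ** pb = g"
    unfolding pa_def pb_def prod hermr_square[OF ab(1)] hermr_square[OF ab(2)] by (rule g[symmetric])+
  have comm: "pb ** ?H ** pa = pa ** ?H ** pb"
    by (simp add: pa_def pb_def prod hermr_commute[OF ab])
  have timelike: "timelike g u \<longleftrightarrow> (B *v u) \<bullet> (minkowski *v (B *v u)) < 0" for u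
    unfolding timelike_iff by (subst g) (simp only: form)
  have neg: "u \<bullet> (pa ** ?H ** pb *v u) < 0" if "timelike g u" for u
    using hermr_mult_timelike_neg[OF ab] that by (simp add: pa_def pb_def prod form timelike)
  have pos: "u \<bullet> (pa *v u) > 0" "u \<bullet> (pb *v u) > 0" if "timelike g u" for u
    using hermr_timelike_pos[OF ab] that by (simp_all add: pa_def pb_def form timelike)
  note struct = sym sq comm gH P
  have Qdef: "Q u = Q_tensor g (Pi1 (V_tensor g P) (sq_tensor u)) P" for u
    by (simp add: assms(10-13))
  have rad: "W0_radicand P (Q u) (X u) = ((u \<bullet> (pa *v u))\<^sup>2 - (u \<bullet> (pb *v u))\<^sup>2)\<^sup>2 / 16" if "timelike g u" for u
    unfolding Qdef assms(11) by (rule W0_structure(1)[OF struct neg[OF that]])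
  show ?thesis
  proof (intro conjI allI impI)
    \<comment> \<open>If the two forms agreed on all time-like vectors, \<open>hermr a\<close> and
      \<open>hermr b\<close> would coincide. But their contraction vanishes, while that of
      \<open>hermr a\<close> with itself is the trace of the identity.\<close>
    have "\<exists>u. timelike g u \<and> u \<bullet> (pa *v u) \<noteq> u \<bullet> (pb *v u)"
    proof (rule ccontr)
      assume no: "\<not> ?thesis"
      have "hermr a - hermr b = 0"
      proof (rule symmetric_zero_on_timelike)
        show "transpose (hermr a - hermr b) = hermr a - hermr b"
          using hermr_symmetric[of a] hermr_symmetric[of b] by (simp add: vec_eq_iff transpose_def)
        fix y :: "real^4" assume y: "y \<bullet> (minkowski *v y) < 0"
        have By: "B *v (A *v y) = y" by (simp add: matrix_vector_mul_assoc AB)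
        have "timelike g (A *v y)" by (simp add: timelike By y)
        then have "(A *v y) \<bullet> (pa *v (A *v y)) = (A *v y) \<bullet> (pb *v (A *v y))" using no by blast
        then show "y \<bullet> ((hermr a - hermr b) *v y) = 0"
          unfolding pa_def pb_def form By by (simp add: matrix_vector_mult_diff_rdistrib inner_diff_right)
      qed
      then have "hermr b = hermr a" by simp
      then have "trace (minkowski ** hermr a ** minkowski ** hermr a) = 0"
        using hermr_orthogonal[OF ab] by simp
      moreover have "minkowski ** hermr a ** minkowski ** hermr a = mat 1"
      proof -
        have "minkowski ** hermr a ** minkowski ** hermr a = minkowski ** (hermr a ** minkowski ** hermr a)"
          by (simp add: matrix_mul_assoc)
        then show ?thesis
          by (simp add: hermr_square ab)
            (simp add: vec_eq_iff forall_4 matrix_matrix_mult_def sum_4 minkowski_def mat_def)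
      qed
      ultimately show False by (simp add: trace_I)
    qed
    then obtain u where u: "timelike g u" "u \<bullet> (pa *v u) \<noteq> u \<bullet> (pb *v u)" by blast
    have "act_vec g (\<Pi>\<^sub>1 u) u \<noteq> u"
      unfolding assms(10-12) by (rule act_vec_Pi1[OF struct neg[OF u(1)]])
    moreover have "W0_radicand P (Q u) (X u) \<noteq> 0"
      using pos[OF u(1)] u(2) by (simp add: rad[OF u(1)] power2_eq_iff)
    ultimately show "\<exists>u. timelike g u \<and> act_vec g (\<Pi>\<^sub>1 u) u \<noteq> u \<and> W0_radicand P (Q u) (X u) \<noteq> 0"
      using u by blast
  next
    fix u assume u: "timelike g u \<and> act_vec g (\<Pi>\<^sub>1 u) u \<noteq> u \<and> W0_radicand P (Q u) (X u) \<noteq> 0"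
    then have tu: "timelike g u" by blast
    show "quad4 V (X u) > 0"
      unfolding assms(10,11) quad4_V_tensor[OF struct] using neg[OF tu] by simp
    show "W0_radicand P (Q u) (X u) > 0"
      using u unfolding rad[OF tu] by simp
    define d where "d = (u \<bullet> (pa *v u))\<^sup>2 - (u \<bullet> (pb *v u))\<^sup>2"
    have d: "d \<noteq> 0" using u rad[OF tu] by (auto simp: d_def)
    define Y where "Y \<alpha> \<beta> \<mu> \<nu> = sd_frame B a $ \<alpha> $ \<beta> * sd_frame B a $ \<mu> $ \<nu> - sd_frame B b $ \<alpha> $ \<beta> * sd_frame B b $ \<mu> $ \<nu>" for \<alpha> \<beta> \<mu> \<nu>
    \<comment> \<open>The real factor combines \<open>sqrt t / 2 = |l|\<close>, the sign of
      \<open>d\<close> and the -2 of \<open>minor2_hermr\<close>.\<close>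
    define x where "x = complex_of_real (- 2 * norm l * sgn d)"
    have W0: "W0_tensor t P (Q u) (X u) \<alpha> \<beta> \<mu> \<nu> = Re (x * Y \<alpha> \<beta> \<mu> \<nu>)" for \<alpha> \<beta> \<mu> \<nu>
      unfolding Qdef assms(11) W0_structure(2)[OF struct neg[OF tu]] d_def[symmetric]
      unfolding pa_def pb_def minor2_hermr[OF ab(1,2)] Y_def[symmetric]
      by (simp add: x_def sqt)
    have hW0: "hodge g s (W0_tensor t P (Q u) (X u)) \<alpha> \<beta> \<mu> \<nu> = Re (\<i> * (x * Y \<alpha> \<beta> \<mu> \<nu>))" for \<alpha> \<beta> \<mu> \<nu>
      using hodge_of_real_part[OF AB vol inv, of "W0_tensor t P (Q u) (X u)" a "\<lambda>\<mu> \<nu>. x * sd_frame B a $ \<mu> $ \<nu>"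
          b "\<lambda>\<mu> \<nu>. - x * sd_frame B b $ \<mu> $ \<nu>"]
      by (simp add: W0 Y_def algebra_simps)
    have W: "W \<alpha> \<beta> \<mu> \<nu> = Re (2 * l * Y \<alpha> \<beta> \<mu> \<nu>)" for \<alpha> \<beta> \<mu> \<nu>
    proof -
      have "self_dual_weyl g s W \<alpha> \<beta> \<mu> \<nu> = (C ** M ** transpose C) $ (\<alpha>, \<beta>) $ (\<mu>, \<nu>)"
        by (simp flip: CM)
      also have "\<dots> = (\<Sum>j\<in>UNIV. \<Sum>i\<in>UNIV. l * ((C $ (\<mu>, \<nu>) $ j * a $ j) * (C $ (\<alpha>, \<beta>) $ i * a $ i))
          + (- l) * ((C $ (\<mu>, \<nu>) $ j * b $ j) * (C $ (\<alpha>, \<beta>) $ i * b $ i)))"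
        unfolding congruence_nth M by (intro sum.cong refl) (simp add: algebra_simps)
      also have "\<dots> = l * Y \<alpha> \<beta> \<mu> \<nu>"
        unfolding sum2_linear sum_product[symmetric] C_def sdcol_frame_sum Y_def by (simp add: algebra_simps)
      finally have "self_dual_weyl g s W \<alpha> \<beta> \<mu> \<nu> = l * Y \<alpha> \<beta> \<mu> \<nu>" .
      moreover have "W \<alpha> \<beta> \<mu> \<nu> = 2 * Re (self_dual_weyl g s W \<alpha> \<beta> \<mu> \<nu>)"
        by (simp add: self_dual_weyl_def)
      ultimately show ?thesis by simp
    qed
    \<comment> \<open>Since \<open>x\<close> is real of modulus \<open>2 |l|\<close>, the required
      \<open>cis \<theta> * x = 2 * l\<close> holds for the argument of \<open>l\<close> corrected
      by the sign of \<open>x\<close>.\<close>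
    define \<theta> where "\<theta> = Arg (- of_real (sgn d) * l)"
    have "cis \<theta> = sgn (- of_real (sgn d) * l)"
      unfolding \<theta>_def using d l0 by (intro cis_Arg) (simp add: sgn_if)
    then have "cis \<theta> * x = 2 * l"
      using d l0 by (simp add: x_def sgn_if sgn_eq)
    then have W': "W \<alpha> \<beta> \<mu> \<nu> = Re (cis \<theta> * (x * Y \<alpha> \<beta> \<mu> \<nu>))" for \<alpha> \<beta> \<mu> \<nu>
      by (simp only: W mult.assoc[symmetric])
    \<comment> \<open>Duality multiplies by \<i> under the real part, and \<open>Re (cis \<theta> z)
      = cos \<theta> Re z + sin \<theta> Re (\<i> z)\<close>.\<close>
    show "\<exists>\<theta>::real. \<forall>\<alpha> \<beta> \<mu> \<nu>.
          W \<alpha> \<beta> \<mu> \<nu> = cos \<theta> * W0_tensor t P (Q u) (X u) \<alpha> \<beta> \<mu> \<nu>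
                     + sin \<theta> * hodge g s (W0_tensor t P (Q u) (X u)) \<alpha> \<beta> \<mu> \<nu>"
      by (rule exI[of _ \<theta>]) (simp add: W' W0 hW0 algebra_simps)
  qed
qed

end
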